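(* Let $(M,\phi,\xi,\eta,g)$ be a $5$-dimensional nearly Sasakian manifold. For a real number $r$, let $\bar\nabla$ be the canonical connection defined by $\bar\nabla_XY=\nabla_XY+H(X,Y)$ with $$H(X,Y)=\tfrac12(\nabla_X\phi)\phi Y-r\,\eta(X)\phi Y+\eta(Y)(\phi-h)X-\tfrac12 g((\phi-h)X,Y)\xi.$$ Then the structure tensor $h$ is parallel with respect to $\bar\nabla$ if and only if $r=\frac12$.
   Context: All manifolds are smooth and connected; $\nabla$ is the Levi-Civita connection of $g$. An almost contact metric structure $(\phi,\xi,\eta,g)$ on $M^{2n+1}$ consists of a $(1,1)$-tensor field $\phi$, a vector field $\xi$, a $1$-form $\eta$ and a Riemannian metric $g$ with $\phi^2=-I+\eta\otimes\xi$, $\eta(\xi)=1$, $g(\phi X,\phi Y)=g(X,Y)-\eta(X)\eta(Y)$. It is nearly Sasakian if $(\nabla_X\phi)Y+(\nabla_Y\phi)X=2g(X,Y)\xi-\eta(X)Y-\eta(Y)X$ for all vector fields $X,Y$. The structure tensor $h$ of a nearly Sasakian manifold is the $(1,1)$-tensor field defined by $\nabla_X\xi=-\phi X+hX$.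
   Formalization: That h parallel implies r = 1/2 is proved only when h is not identically zero: on a Sasakian 5-manifold (e.g. the standard S^5) h = 0 is parallel for every r, so the stated equivalence fails there; r = 1/2 implies h parallel is proved in all cases. *)

theory Defs
  imports "HOL-Analysis.Analysis" "HOL-Library.Function_Algebras"
begin

section \<open>Pointwise vector space structure on function spaces\<close>

text \<open>Real functions on \<open>M\<close>, tangent vectors (functionals on real functions) and vector fields are
  all functions; together with \<^theory>\<open>HOL-Library.Function_Algebras\<close> this instance provides their
  pointwise linear structure.\<close>

instantiation "fun" :: (type, real_vector) real_vector
begin

definition scaleR_fun :: "real \<Rightarrow> ('a \<Rightarrow> 'b) \<Rightarrow> 'a \<Rightarrow> 'b"
  where "c *\<^sub>R f = (\<lambda>x. c *\<^sub>R f x)"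

instance
  by standard (simp_all add: scaleR_fun_def fun_eq_iff scaleR_add_right scaleR_add_left)

end

lemma scaleR_fun_apply [simp]: "(c *\<^sub>R f) x = c *\<^sub>R f x"
  by (simp add: scaleR_fun_def)


section \<open>Smooth maps between Euclidean spaces\<close>

text \<open>Only used for open \<open>S\<close>.\<close>

fun Ck_on :: "nat \<Rightarrow> 'e::euclidean_space set \<Rightarrow> ('e \<Rightarrow> 'b::real_normed_vector) \<Rightarrow> bool" where
  "Ck_on 0 S f \<longleftrightarrow> continuous_on S f"
| "Ck_on (Suc k) S f \<longleftrightarrow>
     (\<forall>x\<in>S. f differentiable (at x)) \<and> (\<forall>v. Ck_on k S (\<lambda>x. frechet_derivative f (at x) v))"

definition smooth_on :: "'e::euclidean_space set \<Rightarrow> ('e \<Rightarrow> 'b::real_normed_vector) \<Rightarrow> bool"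
  where "smooth_on S f \<longleftrightarrow> (\<forall>k. Ck_on k S f)"


section \<open>Smooth manifolds\<close>

text \<open>The manifold is the whole type \<open>'m\<close>, whose class makes it Hausdorff and second countable;
  \<open>'e\<close> is the Euclidean model space. A chart is a pair of a domain and a coordinate map, the values
  of the latter outside the domain being irrelevant. The smooth structure is given by an atlas, which
  need not be maximal.\<close>

type_synonym ('m, 'e) chart = "'m set \<times> ('m \<Rightarrow> 'e)"

definition is_chart :: "('m::topological_space, 'e::euclidean_space) chart \<Rightarrow> bool"
  where "is_chart = (\<lambda>(U, c). open U \<and> open (c ` U) \<and> homeomorphism U (c ` U) c (inv_into U c))"

definition smooth_atlas :: "('m::topological_space, 'e::euclidean_space) chart set \<Rightarrow> bool"
  where "smooth_atlas A \<longleftrightarrow>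
    (\<forall>K\<in>A. is_chart K) \<and> (\<Union>K\<in>A. fst K) = UNIV \<and>
    (\<forall>(U, c)\<in>A. \<forall>(V, d)\<in>A. smooth_on (c ` (U \<inter> V)) (d \<circ> inv_into U c))"

definition connected_manifold ::
  "('m::{t2_space, second_countable_topology}, 'e::euclidean_space) chart set \<Rightarrow> bool"
  where "connected_manifold A \<longleftrightarrow> smooth_atlas A \<and> connected (UNIV :: 'm set)"

definition smooth_functions ::
  "('m::topological_space, 'e::euclidean_space) chart set \<Rightarrow> ('m \<Rightarrow> real) set"
  where "smooth_functions A = {f. \<forall>(U, c)\<in>A. smooth_on (c ` U) (f \<circ> inv_into U c)}"


section \<open>Tangent vectors and vector fields\<close>

type_synonym 'm tangent = "('m \<Rightarrow> real) \<Rightarrow> real"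
type_synonym 'm vfield = "'m \<Rightarrow> 'm tangent"

text \<open>A tangent vector at \<open>p\<close> is a derivation at \<open>p\<close> of the algebra of smooth functions. Since the
  functionals are total, they are required to vanish on non-smooth arguments, so that equality of
  tangent vectors is HOL equality.\<close>

definition tangent_space ::
  "('m::topological_space, 'e::euclidean_space) chart set \<Rightarrow> 'm \<Rightarrow> 'm tangent set"
  where "tangent_space A p = {v.
    (\<forall>f. f \<notin> smooth_functions A \<longrightarrow> v f = 0) \<and>
    (\<forall>f\<in>smooth_functions A. \<forall>c. v (c *\<^sub>R f) = c * v f) \<and>
    (\<forall>f\<in>smooth_functions A. \<forall>f'\<in>smooth_functions A.
       v (f + f') = v f + v f' \<and> v (f * f') = v f * f' p + f p * v f')}"

lemma subspace_tangent_space: "subspace (tangent_space A p)"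
  unfolding subspace_def tangent_space_def by (auto simp: algebra_simps)

definition deriv_along :: "'m vfield \<Rightarrow> ('m \<Rightarrow> real) \<Rightarrow> 'm \<Rightarrow> real"
  where "deriv_along X f = (\<lambda>p. X p f)"

definition vector_fields ::
  "('m::topological_space, 'e::euclidean_space) chart set \<Rightarrow> 'm vfield set"
  where "vector_fields A = {X. (\<forall>p. X p \<in> tangent_space A p) \<and>
    (\<forall>f\<in>smooth_functions A. deriv_along X f \<in> smooth_functions A)}"

definition fun_scale :: "('m \<Rightarrow> real) \<Rightarrow> 'm vfield \<Rightarrow> 'm vfield"
  where "fun_scale f X = (\<lambda>p. f p *\<^sub>R X p)"

definition lie_bracket :: "'m vfield \<Rightarrow> 'm vfield \<Rightarrow> 'm vfield"
  where "lie_bracket X Y = (\<lambda>p f. X p (deriv_along Y f) - Y p (deriv_along X f))"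


section \<open>Tensor fields\<close>

text \<open>Tensor fields are families of (multi)linear maps on the tangent spaces whose values on smooth
  vector fields are smooth; values off the tangent spaces are irrelevant.\<close>

definition linear_map_on :: "'v::real_vector set \<Rightarrow> ('v \<Rightarrow> 'w::real_vector) \<Rightarrow> bool"
  where "linear_map_on V f \<longleftrightarrow>
    (\<forall>u\<in>V. \<forall>v\<in>V. f (u + v) = f u + f v) \<and> (\<forall>c. \<forall>v\<in>V. f (c *\<^sub>R v) = c *\<^sub>R f v)"

type_synonym 'm endo_field = "'m \<Rightarrow> 'm tangent \<Rightarrow> 'm tangent"

definition app_endo :: "'m endo_field \<Rightarrow> 'm vfield \<Rightarrow> 'm vfield"
  where "app_endo T X = (\<lambda>p. T p (X p))"

definition tensor_field_1_1 ::
  "('m::topological_space, 'e::euclidean_space) chart set \<Rightarrow> 'm endo_field \<Rightarrow> bool"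
  where "tensor_field_1_1 A T \<longleftrightarrow>
    (\<forall>p. linear_map_on (tangent_space A p) (T p) \<and> T p ` tangent_space A p \<subseteq> tangent_space A p) \<and>
    (\<forall>X\<in>vector_fields A. app_endo T X \<in> vector_fields A)"

definition one_form ::
  "('m::topological_space, 'e::euclidean_space) chart set \<Rightarrow> ('m \<Rightarrow> 'm tangent \<Rightarrow> real) \<Rightarrow> bool"
  where "one_form A \<eta> \<longleftrightarrow>
    (\<forall>p. linear_map_on (tangent_space A p) (\<eta> p)) \<and>
    (\<forall>X\<in>vector_fields A. (\<lambda>p. \<eta> p (X p)) \<in> smooth_functions A)"

definition riemannian_metric ::
  "('m::topological_space, 'e::euclidean_space) chart set
    \<Rightarrow> ('m \<Rightarrow> 'm tangent \<Rightarrow> 'm tangent \<Rightarrow> real) \<Rightarrow> bool"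
  where "riemannian_metric A g \<longleftrightarrow>
    (\<forall>p. \<forall>u\<in>tangent_space A p. linear_map_on (tangent_space A p) (g p u)) \<and>
    (\<forall>p. \<forall>u\<in>tangent_space A p. \<forall>v\<in>tangent_space A p. g p u v = g p v u) \<and>
    (\<forall>p. \<forall>v\<in>tangent_space A p. v \<noteq> 0 \<longrightarrow> g p v v > 0) \<and>
    (\<forall>X\<in>vector_fields A. \<forall>Y\<in>vector_fields A. (\<lambda>p. g p (X p) (Y p)) \<in> smooth_functions A)"


section \<open>Connections\<close>

text \<open>\<open>D X Y\<close> stands for $\nabla_X Y$; only its values on smooth vector fields matter.\<close>

type_synonym 'm connection = "'m vfield \<Rightarrow> 'm vfield \<Rightarrow> 'm vfield"

definition affine_connection ::
  "('m::topological_space, 'e::euclidean_space) chart set \<Rightarrow> 'm connection \<Rightarrow> bool"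
  where "affine_connection A D \<longleftrightarrow>
    (\<forall>X\<in>vector_fields A. \<forall>Y\<in>vector_fields A. D X Y \<in> vector_fields A) \<and>
    (\<forall>X\<in>vector_fields A. \<forall>Y\<in>vector_fields A. \<forall>Z\<in>vector_fields A.
       D (X + Y) Z = D X Z + D Y Z \<and> D X (Y + Z) = D X Y + D X Z) \<and>
    (\<forall>f\<in>smooth_functions A. \<forall>X\<in>vector_fields A. \<forall>Y\<in>vector_fields A.
       D (fun_scale f X) Y = fun_scale f (D X Y) \<and>
       D X (fun_scale f Y) = fun_scale f (D X Y) + fun_scale (deriv_along X f) Y)"

definition levi_civita ::
  "('m::topological_space, 'e::euclidean_space) chart set
    \<Rightarrow> ('m \<Rightarrow> 'm tangent \<Rightarrow> 'm tangent \<Rightarrow> real) \<Rightarrow> 'm connection \<Rightarrow> bool"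
  where "levi_civita A g D \<longleftrightarrow>
    affine_connection A D \<and>
    (\<forall>X\<in>vector_fields A. \<forall>Y\<in>vector_fields A. D X Y - D Y X = lie_bracket X Y) \<and>
    (\<forall>X\<in>vector_fields A. \<forall>Y\<in>vector_fields A. \<forall>Z\<in>vector_fields A. \<forall>p.
       deriv_along X (\<lambda>q. g q (Y q) (Z q)) p = g p (D X Y p) (Z p) + g p (Y p) (D X Z p))"

definition cov_deriv_endo ::
  "'m connection \<Rightarrow> 'm endo_field \<Rightarrow> 'm vfield \<Rightarrow> 'm vfield \<Rightarrow> 'm vfield"
  where "cov_deriv_endo D T X Y = D X (app_endo T Y) - app_endo T (D X Y)"

definition parallel_endo ::
  "('m::topological_space, 'e::euclidean_space) chart set \<Rightarrow> 'm connection \<Rightarrow> 'm endo_field \<Rightarrow> bool"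
  where "parallel_endo A D T \<longleftrightarrow>
    (\<forall>X\<in>vector_fields A. \<forall>Y\<in>vector_fields A. cov_deriv_endo D T X Y = 0)"


section \<open>Nearly Sasakian structures\<close>

definition almost_contact_metric ::
  "('m::topological_space, 'e::euclidean_space) chart set \<Rightarrow> 'm endo_field \<Rightarrow> 'm vfield
    \<Rightarrow> ('m \<Rightarrow> 'm tangent \<Rightarrow> real) \<Rightarrow> ('m \<Rightarrow> 'm tangent \<Rightarrow> 'm tangent \<Rightarrow> real) \<Rightarrow> bool"
  where "almost_contact_metric A \<phi> \<xi> \<eta> g \<longleftrightarrow>
    tensor_field_1_1 A \<phi> \<and> \<xi> \<in> vector_fields A \<and> one_form A \<eta> \<and> riemannian_metric A g \<and>
    (\<forall>p. \<forall>v\<in>tangent_space A p. \<phi> p (\<phi> p v) = - v + \<eta> p v *\<^sub>R \<xi> p) \<and>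
    (\<forall>p. \<eta> p (\<xi> p) = 1) \<and>
    (\<forall>p. \<forall>u\<in>tangent_space A p. \<forall>v\<in>tangent_space A p.
       g p (\<phi> p u) (\<phi> p v) = g p u v - \<eta> p u * \<eta> p v)"

text \<open>\<open>D\<close> is meant to be the Levi-Civita connection of \<open>g\<close>.\<close>

definition nearly_sasakian ::
  "('m::topological_space, 'e::euclidean_space) chart set \<Rightarrow> 'm endo_field \<Rightarrow> 'm vfield
    \<Rightarrow> ('m \<Rightarrow> 'm tangent \<Rightarrow> real) \<Rightarrow> ('m \<Rightarrow> 'm tangent \<Rightarrow> 'm tangent \<Rightarrow> real)
    \<Rightarrow> 'm connection \<Rightarrow> bool"
  where "nearly_sasakian A \<phi> \<xi> \<eta> g D \<longleftrightarrow>
    almost_contact_metric A \<phi> \<xi> \<eta> g \<and>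
    (\<forall>X\<in>vector_fields A. \<forall>Y\<in>vector_fields A. \<forall>p.
       cov_deriv_endo D \<phi> X Y p + cov_deriv_endo D \<phi> Y X p
       = (2 * g p (X p) (Y p)) *\<^sub>R \<xi> p - \<eta> p (X p) *\<^sub>R Y p - \<eta> p (Y p) *\<^sub>R X p)"

definition structure_tensor ::
  "('m::topological_space, 'e::euclidean_space) chart set \<Rightarrow> 'm endo_field \<Rightarrow> 'm vfield
    \<Rightarrow> 'm connection \<Rightarrow> 'm endo_field \<Rightarrow> bool"
  where "structure_tensor A \<phi> \<xi> D h \<longleftrightarrow>
    tensor_field_1_1 A h \<and>
    (\<forall>X\<in>vector_fields A. D X \<xi> = - app_endo \<phi> X + app_endo h X)"

definition canonical_difference ::
  "'m endo_field \<Rightarrow> 'm vfield \<Rightarrow> ('m \<Rightarrow> 'm tangent \<Rightarrow> real)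
    \<Rightarrow> ('m \<Rightarrow> 'm tangent \<Rightarrow> 'm tangent \<Rightarrow> real) \<Rightarrow> 'm connection \<Rightarrow> 'm endo_field
    \<Rightarrow> real \<Rightarrow> 'm vfield \<Rightarrow> 'm vfield \<Rightarrow> 'm vfield"
  where "canonical_difference \<phi> \<xi> \<eta> g D h r X Y = (\<lambda>p.
    (1/2) *\<^sub>R cov_deriv_endo D \<phi> X (app_endo \<phi> Y) p
    - (r * \<eta> p (X p)) *\<^sub>R \<phi> p (Y p)
    + \<eta> p (Y p) *\<^sub>R (\<phi> p (X p) - h p (X p))
    - (1/2 * g p (\<phi> p (X p) - h p (X p)) (Y p)) *\<^sub>R \<xi> p)"

definition canonical_connection ::
  "'m endo_field \<Rightarrow> 'm vfield \<Rightarrow> ('m \<Rightarrow> 'm tangent \<Rightarrow> real)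
    \<Rightarrow> ('m \<Rightarrow> 'm tangent \<Rightarrow> 'm tangent \<Rightarrow> real) \<Rightarrow> 'm connection \<Rightarrow> 'm endo_field
    \<Rightarrow> real \<Rightarrow> 'm connection"
  where "canonical_connection \<phi> \<xi> \<eta> g D h r = (\<lambda>X Y. D X Y + canonical_difference \<phi> \<xi> \<eta> g D h r X Y)"

text \<open>A Sasakian manifold is nearly Sasakian with \<open>h = 0\<close> (indeed \<open>h = 0\<close> characterises the Sasakian
  ones among the nearly Sasakian), and then \<open>h\<close> is parallel for every \<open>r\<close>. The following predicate
  singles out this degenerate case.\<close>

definition vanishing_endo ::
  "('m::topological_space, 'e::euclidean_space) chart set \<Rightarrow> 'm endo_field \<Rightarrow> bool"
  where "vanishing_endo A T \<longleftrightarrow> (\<forall>p. \<forall>v\<in>tangent_space A p. T p v = 0)"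

end

theory Submission
  imports Defs "HOL-Computational_Algebra.Polynomial"
begin

text \<open>Write \<open>H\<close> for the kernel of \<open>\<eta>\<close>. The nearly Sasakian identity makes \<open>g ((\<nabla>\<^sub>X \<phi>) Y, Z)\<close> a 3-form on
  \<open>H\<close>, of type \<open>(3,0) + (0,3)\<close> with respect to \<open>\<phi>\<close>. In dimension five \<open>H\<close> has complex dimension two, so
  this form vanishes and \<open>\<nabla>\<phi>\<close> is an algebraic expression in \<open>\<phi>\<close>, \<open>h\<close>, \<open>\<eta>\<close>, \<open>g\<close>. The field \<open>\<xi>\<close> is Killing,
  so Kostant's formula gives \<open>R(X, \<xi>) = \<nabla>\<^sub>X h - \<nabla>\<^sub>X \<phi>\<close>. Inserting this into the Ricci identity for \<open>\<phi>\<close>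
  kills the part of \<open>\<nabla>h\<close> on \<open>H\<close>, and hence
  \<open>(\<nabla>\<^sub>X h) Y = \<eta>(X) \<phi> h Y - \<eta>(Y) (\<phi> h + h\<^sup>2) X + g ((\<phi> h + h\<^sup>2) X, Y) \<xi>\<close>.
  For the canonical connection everything cancels except \<open>(1 - 2 r) \<eta>(X) \<phi> h Y\<close>.

  The pointwise arguments need that tangent vectors, defined as derivations at a point, extend to vector
  fields and form a space of dimension at most five; both follow from Hadamard's lemma and bump functions.\<close>

section \<open>Calculus of smooth maps\<close>

text \<open>The value of \<open>r\<close> is decided along \<open>\<xi>\<close>. There the canonical
  connection differs from \<open>D\<close> by the endomorphism \<open>(1/2) h - r \<phi>\<close>.
  Since \<open>h\<close> anticommutes with \<open>\<phi>\<close>, the commutator of that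
  endomorphism with \<open>h\<close> is \<open>- 2 r \<phi> h\<close>, whereas the derivative of
  \<open>h\<close> along \<open>\<xi>\<close> is \<open>\<phi> h\<close>; the sum is
  \<open>(1 - 2 r) \<phi> h\<close>. A difficulty runs through the whole proof: \<open>D\<close>
  acts on global vector fields, the tensors act on single tangent vectors, and a tangent vector acts
  on global functions only. Hence the cut-off constructions at the start. Later, horizontality at
  one point suffices for \<open>\<nabla>\<phi>\<close>, but for \<open>\<nabla>h\<close> the fields
  must be horizontal everywhere, because horizontality is itself differentiated. Equations between
  vectors are tested with \<open>g\<close> against an arbitrary tangent vector, which turns them
  into real identities.\<close>

lemma Ck_on_cong:
  assumes "open S" "\<And>x. x \<in> S \<Longrightarrow> f x = g x" "Ck_on k S f"
  shows "Ck_on k S g"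
  using assms(2,3)
proof (induction k arbitrary: f g)
  case 0
  then show ?case using continuous_on_cong[of S S f g] by simp
next
  case (Suc k)
  have d: "f differentiable (at x)" if "x \<in> S" for x
    using Suc.prems(2) that by simp
  have "g differentiable (at x)" if "x \<in> S" for x
  proof -
    obtain D where D: "(f has_derivative D) (at x)"
      using d[OF \<open>x \<in> S\<close>] by (auto simp: differentiable_def)
    show ?thesis
      using has_derivative_transform_within_open[OF D assms(1) \<open>x \<in> S\<close> Suc.prems(1)]
      by (auto simp: differentiable_def)
  qed
  moreover have "Ck_on k S (\<lambda>x. frechet_derivative g (at x) v)" for v
  proof (rule Suc.IH)
    show "Ck_on k S (\<lambda>x. frechet_derivative f (at x) v)"
      using Suc.prems(2) by simp
    show "frechet_derivative f (at x) v = frechet_derivative g (at x) v" if "x \<in> S" for x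
      using frechet_derivative_transform_within_open[OF d[OF that] assms(1) that Suc.prems(1)] by simp
  qed
  ultimately show ?case by simp
qed

lemma Ck_on_subset: "Ck_on k S f \<Longrightarrow> T \<subseteq> S \<Longrightarrow> Ck_on k T f"
  by (induction k arbitrary: f) (auto intro: continuous_on_subset)

lemma Ck_on_SucD: "Ck_on (Suc k) S f \<Longrightarrow> Ck_on k S f"
proof (induction k arbitrary: f)
  case 0
  then show ?case
    by (auto intro!: continuous_at_imp_continuous_on differentiable_imp_continuous_within)
next
  case (Suc k)
  then show ?case by simp
qed

text \<open>The explicit witness \<open>f'\<close> keeps \<open>frechet_derivative\<close> of
  compound functions out of the induction steps below.\<close>

lemma Ck_on_SucI:
  assumes "open S" "\<And>x. x \<in> S \<Longrightarrow> (f has_derivative f' x) (at x)"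
    "\<And>v. Ck_on k S (\<lambda>x. f' x v)"
  shows "Ck_on (Suc k) S f"
proof -
  have "Ck_on k S (\<lambda>x. frechet_derivative f (at x) v)" for v
    using assms(2) frechet_derivative_at
    by (intro Ck_on_cong[OF assms(1) _ assms(3)[of v]]) fastforce
  then show ?thesis using assms(2) by (auto simp: differentiable_def)
qed

lemma Ck_on_has_derivative:
  "Ck_on (Suc k) S f \<Longrightarrow> x \<in> S \<Longrightarrow> (f has_derivative frechet_derivative f (at x)) (at x)"
  by (simp add: frechet_derivative_works[symmetric])

text \<open>Differentiability refers to full neighbourhoods of each point, so openness matters for
  the continuity in the base case only.\<close>

lemma Ck_on_Un:
  assumes "open S" "open T" "Ck_on k S f" "Ck_on k T f"
  shows "Ck_on k (S \<union> T) f"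
  using assms(3,4)
proof (induction k arbitrary: f)
  case 0
  then show ?case using assms(1,2) by (simp add: continuous_on_open_Un)
next
  case (Suc k)
  then show ?case by auto
qed

lemma Ck_on_const: "open S \<Longrightarrow> Ck_on k S (\<lambda>x. c)"
proof (induction k arbitrary: c)
  case (Suc k)
  show ?case by (rule Ck_on_SucI[where f' = "\<lambda>x v. 0"]) (use Suc in auto)
qed simp

lemma Ck_on_add:
  assumes "open S"
  shows "Ck_on k S f \<Longrightarrow> Ck_on k S g \<Longrightarrow> Ck_on k S (\<lambda>x. f x + g x)"
proof (induction k arbitrary: f g)
  case 0
  then show ?case by (simp add: continuous_on_add)
next
  case (Suc k)
  show ?case
  proof (rule Ck_on_SucI[OF assms])
    show "((\<lambda>x. f x + g x) has_derivative
        (\<lambda>v. frechet_derivative f (at x) v + frechet_derivative g (at x) v)) (at x)"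
      if "x \<in> S" for x
      using Suc.prems[THEN Ck_on_has_derivative, OF that] by (rule has_derivative_add)
  qed (use Suc in simp)
qed

lemma Ck_on_sum:
  assumes "open S" "finite I" "\<And>i. i \<in> I \<Longrightarrow> Ck_on k S (f i)"
  shows "Ck_on k S (\<lambda>x. \<Sum>i\<in>I. f i x)"
  using assms(2,3) by (induction I) (auto intro: Ck_on_const Ck_on_add assms(1))

lemma Ck_on_bounded_linear:
  assumes "open S" "bounded_linear L"
  shows "Ck_on k S f \<Longrightarrow> Ck_on k S (\<lambda>x. L (f x))"
proof (induction k arbitrary: f)
  case 0
  then show ?case using bounded_linear.continuous_on[OF assms(2)] by simp
next
  case (Suc k)
  show ?case
  proof (rule Ck_on_SucI[OF assms(1)])
    show "((\<lambda>x. L (f x)) has_derivative (\<lambda>v. L (frechet_derivative f (at x) v))) (at x)"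
      if "x \<in> S" for x
      using Suc.prems[THEN Ck_on_has_derivative, OF that]
      by (rule bounded_linear.has_derivative[OF assms(2)])
  qed (use Suc in simp)
qed

lemma Ck_on_scaleR:
  fixes f :: "'e::euclidean_space \<Rightarrow> real"
  assumes "open S"
  shows "Ck_on k S f \<Longrightarrow> Ck_on k S g \<Longrightarrow> Ck_on k S (\<lambda>x. f x *\<^sub>R g x)"
proof (induction k arbitrary: f g)
  case 0
  then show ?case by (simp add: continuous_on_scaleR)
next
  case (Suc k)
  show ?case
  proof (rule Ck_on_SucI[OF assms])
    show "((\<lambda>x. f x *\<^sub>R g x) has_derivative
        (\<lambda>v. f x *\<^sub>R frechet_derivative g (at x) v + frechet_derivative f (at x) v *\<^sub>R g x)) (at x)"
      if "x \<in> S" for x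
      using Suc.prems[THEN Ck_on_has_derivative, OF that] by (rule has_derivative_scaleR)
    show "Ck_on k S (\<lambda>x. f x *\<^sub>R frechet_derivative g (at x) v + frechet_derivative f (at x) v *\<^sub>R g x)" for v
      using Suc.prems[THEN Ck_on_SucD] Suc.prems by (intro Ck_on_add[OF assms] Suc.IH) auto
  qed
qed

lemma Ck_on_mult:
  fixes f g :: "'e::euclidean_space \<Rightarrow> real"
  shows "open S \<Longrightarrow> Ck_on k S f \<Longrightarrow> Ck_on k S g \<Longrightarrow> Ck_on k S (\<lambda>x. f x * g x)"
  using Ck_on_scaleR[of S k f g] by simp

lemma Ck_on_id: "open S \<Longrightarrow> Ck_on k S (\<lambda>x. x)"
proof (cases k)
  case (Suc m)
  assume "open S"
  then show ?thesis unfolding Suc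
    by (intro Ck_on_SucI[where f' = "\<lambda>x v. v"]) (auto intro: Ck_on_const)
qed simp

text \<open>In the chain rule the direction fed to the derivative of \<open>G\<close> varies with
  \<open>x\<close>. Expanding it in the basis leaves derivatives of \<open>G\<close> in fixed
  directions, composed with \<open>T\<close>, to which the induction hypothesis applies.\<close>

lemma Ck_on_compose:
  fixes T :: "'e::euclidean_space \<Rightarrow> 'f::euclidean_space" and G :: "'f \<Rightarrow> 'b::real_normed_vector"
  assumes "open S" "open W" "T ` S \<subseteq> W"
  shows "Ck_on k S T \<Longrightarrow> Ck_on k W G \<Longrightarrow> Ck_on k S (\<lambda>x. G (T x))"
proof (induction k arbitrary: G)
  case 0
  then show ?case using continuous_on_compose2[OF _ _ assms(3)] by simp
next
  case (Suc k)
  let ?T' = "\<lambda>x. frechet_derivative T (at x)" and ?G' = "\<lambda>y. frechet_derivative G (at y)"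
  show ?case
  proof (rule Ck_on_SucI[OF assms(1)])
    show "((\<lambda>x. G (T x)) has_derivative (\<lambda>v. \<Sum>b\<in>Basis. (?T' x v \<bullet> b) *\<^sub>R ?G' (T x) b)) (at x)"
      if "x \<in> S" for x
    proof -
      have 1: "(T has_derivative ?T' x) (at x)"
        using Suc.prems(1) that by (rule Ck_on_has_derivative)
      have 2: "(G has_derivative ?G' (T x)) (at (T x))"
        using Suc.prems(2) by (rule Ck_on_has_derivative) (use assms(3) that in auto)
      have "((\<lambda>x. G (T x)) has_derivative (\<lambda>v. ?G' (T x) (?T' x v))) (at x)"
        using has_derivative_compose[OF 1 2] .
      moreover have "?G' (T x) (?T' x v) = (\<Sum>b\<in>Basis. (?T' x v \<bullet> b) *\<^sub>R ?G' (T x) b)" for v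
      proof -
        have lin: "linear (?G' (T x))"
          using has_derivative_linear[OF 2] .
        have "?G' (T x) (\<Sum>b\<in>Basis. (?T' x v \<bullet> b) *\<^sub>R b)
            = (\<Sum>b\<in>Basis. (?T' x v \<bullet> b) *\<^sub>R ?G' (T x) b)"
          by (simp add: linear_sum[OF lin] linear_cmul[OF lin])
        then show ?thesis by (simp only: euclidean_representation)
      qed
      ultimately show ?thesis by (simp only:)
    qed
    show "Ck_on k S (\<lambda>x. \<Sum>b\<in>Basis. (?T' x v \<bullet> b) *\<^sub>R ?G' (T x) b)" for v
    proof (intro Ck_on_sum Ck_on_scaleR assms(1) finite_Basis)
      show "Ck_on k S (\<lambda>x. ?T' x v \<bullet> b)" for b
        using Suc.prems(1) by (intro Ck_on_bounded_linear[OF assms(1) bounded_linear_inner_left]) simp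
      show "Ck_on k S (\<lambda>x. ?G' (T x) b)" for b
        using Suc.prems(2) by (intro Suc.IH Ck_on_SucD[OF Suc.prems(1)]) simp
    qed
  qed
qed


subsection \<open>A smooth bump function\<close>

text \<open>The polynomial factor makes the family closed under differentiation.\<close>

definition flat_exp :: "real poly \<Rightarrow> real \<Rightarrow> real"
  where "flat_exp P x = (if x > 0 then poly P (1 / x) * exp (- (1 / x)) else 0)"

lemma tendsto_poly_exp: "((\<lambda>x::real. poly P x * exp (- x)) \<longlongrightarrow> 0) at_top"
proof -
  have "((\<lambda>x::real. \<Sum>i\<le>degree P. coeff P i * (x ^ i / exp x)) \<longlongrightarrow> (\<Sum>i\<le>degree P. coeff P i * 0)) at_top"
    by (intro tendsto_sum tendsto_mult tendsto_const tendsto_power_div_exp_0)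
  then show ?thesis
    by (simp add: poly_altdef exp_minus sum_distrib_right divide_inverse mult.assoc)
qed

lemma tendsto_flat_exp: "(flat_exp P \<longlongrightarrow> 0) (at 0)"
proof -
  have "((\<lambda>x. poly P (inverse x) * exp (- inverse x)) \<longlongrightarrow> 0) (at_right 0)"
    using filterlim_compose[OF tendsto_poly_exp filterlim_inverse_at_top_right] .
  then have "(flat_exp P \<longlongrightarrow> 0) (at_right 0)"
    by (rule Lim_transform_eventually)
       (auto simp: flat_exp_def eventually_at_right_less divide_inverse
         intro!: eventually_mono[OF eventually_at_right_less])
  moreover have "(flat_exp P \<longlongrightarrow> 0) (at_left 0)"
    by (rule Lim_transform_eventually[OF tendsto_const])
       (auto simp: flat_exp_def eventually_at_left_field intro!: exI[of _ "-1"])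
  ultimately show ?thesis by (simp add: filterlim_split_at)
qed

text \<open>By the chain rule \<open>1 / x\<close> contributes the factor \<open>1 / x^2\<close>,
  that is \<open>monom 1 2\<close>; the exponential gives \<open>P\<close> and the polynomial gives
  \<open>- pderiv P\<close>. At 0 the difference quotient is again a flat function, with one more
  factor \<open>1 / x\<close>.\<close>

lemma flat_exp_derivative:
  "(flat_exp P has_real_derivative flat_exp ((P - pderiv P) * monom 1 2) x) (at x)"
proof -
  consider "x > 0" | "x < 0" | "x = 0" by linarith
  then show ?thesis
  proof cases
    case 1
    have "((\<lambda>x. poly P (1 / x) * exp (- (1 / x))) has_real_derivative
        poly ((P - pderiv P) * monom 1 2) (1 / x) * exp (- (1 / x))) (at x)"
      using 1
      by (auto intro!: derivative_eq_intros DERIV_chain'[OF _ poly_DERIV]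
          simp: poly_monom field_simps power2_eq_square)
    then show ?thesis
      using 1 by (subst DERIV_cong_ev[OF refl _ refl, of _ "\<lambda>x. poly P (1 / x) * exp (- (1 / x))"])
        (auto simp: flat_exp_def eventually_nhds intro!: exI[of _ "{0<..}"])
  next
    case 2
    then show ?thesis
      by (subst DERIV_cong_ev[OF refl _ refl, of _ "\<lambda>x. 0"])
        (auto simp: flat_exp_def eventually_nhds intro!: exI[of _ "{..<0}"])
  next
    case 3
    have "(flat_exp P h - flat_exp P 0) / h = flat_exp (P * monom 1 1) h" for h
      by (simp add: flat_exp_def poly_monom field_simps)
    then show ?thesis
      unfolding 3 using tendsto_flat_exp[of "P * monom 1 1"]
      by (simp add: DERIV_def flat_exp_def[of _ 0])
  qed
qed

lemma Ck_on_flat_exp: "Ck_on k UNIV (flat_exp P)"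
proof (induction k arbitrary: P)
  case 0
  then show ?case
    using flat_exp_derivative by (auto intro: DERIV_continuous_on)
next
  case (Suc k)
  show ?case
  proof (rule Ck_on_SucI[OF open_UNIV])
    show "(flat_exp P has_derivative (*) (flat_exp ((P - pderiv P) * monom 1 2) x)) (at x)" for x
      using flat_exp_derivative by (simp add: has_field_derivative_def)
    show "Ck_on k UNIV (\<lambda>x. flat_exp ((P - pderiv P) * monom 1 2) x * v)" for v
      using Suc by (intro Ck_on_mult Ck_on_const) auto
  qed
qed

text \<open>It equals 1 at the centre without a plateau: later its derivative at \<open>a\<close>
  always meets a factor that vanishes there. The squared distance is written as an inner product, a
  polynomial in the coordinates, so that smoothness at the centre is immediate.\<close>

definition bump :: "'e::euclidean_space \<Rightarrow> real \<Rightarrow> 'e \<Rightarrow> real"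
  where "bump a e y = flat_exp 1 (e\<^sup>2 - (y - a) \<bullet> (y - a)) / flat_exp 1 (e\<^sup>2)"

lemma bump_center: "e > 0 \<Longrightarrow> bump a e a = 1"
  by (simp add: bump_def flat_exp_def)

lemma bump_outside: "e > 0 \<Longrightarrow> y \<notin> cball a e \<Longrightarrow> bump a e y = 0"
proof -
  assume "e > 0" "y \<notin> cball a e"
  then have "e\<^sup>2 \<le> (norm (y - a))\<^sup>2"
    by (intro power_mono) (auto simp: dist_norm norm_minus_commute)
  then show ?thesis by (simp add: bump_def flat_exp_def power2_norm_eq_inner)
qed

lemma Ck_on_bump:
  assumes "open S"
  shows "Ck_on k S (bump a e)"
proof -
  have aff: "Ck_on k S (\<lambda>y. y - a)" for k
    using Ck_on_add[OF assms Ck_on_id[OF assms] Ck_on_const[OF assms, of k "- a"]] by simp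
  have "Ck_on k S (\<lambda>y. \<Sum>b\<in>Basis. ((y - a) \<bullet> b) * ((y - a) \<bullet> b))"
    by (intro Ck_on_sum Ck_on_mult assms finite_Basis
        Ck_on_bounded_linear[OF assms bounded_linear_inner_left aff])
  then have "Ck_on k S (\<lambda>y. (y - a) \<bullet> (y - a))"
    by (simp add: euclidean_inner[of "_ - a" "_ - a"])
  then have "Ck_on k S (\<lambda>y. e\<^sup>2 + (-1) * ((y - a) \<bullet> (y - a)))"
    by (intro Ck_on_add Ck_on_mult Ck_on_const assms)
  then have "Ck_on k S (\<lambda>y. flat_exp 1 (e\<^sup>2 + (-1) * ((y - a) \<bullet> (y - a))))"
    by (intro Ck_on_compose[OF assms open_UNIV _ _ Ck_on_flat_exp]) auto
  then have "Ck_on k S (\<lambda>y. flat_exp 1 (e\<^sup>2 + (-1) * ((y - a) \<bullet> (y - a))) * (1 / flat_exp 1 (e\<^sup>2)))"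
    by (intro Ck_on_mult Ck_on_const assms)
  then show ?thesis by (simp add: bump_def[abs_def])
qed


subsection \<open>Hadamard's lemma\<close>

text \<open>The weight \<open>w\<close> is there for the induction: differentiating in \<open>y\<close> produces a factor \<open>t\<close>.\<close>

lemma Ck_on_segment_integral:
  fixes a :: "'e::euclidean_space"
  assumes "e > 0"
  shows "Ck_on k (ball a e) h \<Longrightarrow> continuous_on {0..1} w \<Longrightarrow>
    Ck_on k (ball a e) (\<lambda>y. integral {0..1} (\<lambda>t. w t * h (a + t *\<^sub>R (y - a)) :: real))"
proof (induction k arbitrary: h w)
  have mem: "a + t *\<^sub>R (y - a) \<in> ball a e" if "y \<in> ball a e" "t \<in> {0..1}" for y t
  proof -
    have "\<bar>t\<bar> * norm (y - a) \<le> 1 * norm (y - a)"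
      using that by (intro mult_right_mono) auto
    then show ?thesis using that by (simp add: dist_norm norm_minus_commute)
  qed
  have cont: "continuous_on (ball a e \<times> {0..1}) (\<lambda>(y, t). w t * h (a + t *\<^sub>R (y - a)))"
    if "continuous_on (ball a e) h" "continuous_on {0..1} w" for h w :: "_ \<Rightarrow> real"
    unfolding split_beta
    by (intro continuous_intros continuous_on_compose2[OF that(1)] continuous_on_compose2[OF that(2)])
       (use mem in auto)
  {
    case 0
    then show ?case
      using integral_continuous_on_param[of "ball a e" 0 1 "\<lambda>y t. w t * h (a + t *\<^sub>R (y - a))"] cont
      by simp
  next
    case (Suc k)
    define f where "f = (\<lambda>y t. w t * h (a + t *\<^sub>R (y - a)))"
    let ?h' = "\<lambda>y. frechet_derivative h (at y)"
    have hd: "(h has_derivative ?h' y) (at y)" if "y \<in> ball a e" for y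
      using Suc.prems(1) that by (rule Ck_on_has_derivative)
    \<comment> \<open>\<open>leibniz_rule\<close> wants the derivative in \<open>y\<close> as a
      bounded linear map depending continuously on \<open>(y, t)\<close>; its continuity is checked
      on basis vectors.\<close>
    define F where "F = (\<lambda>y t. Blinfun (\<lambda>v. (w t * t) * ?h' (a + t *\<^sub>R (y - a)) v))"
    have F: "blinfun_apply (F y t) = (\<lambda>v. (w t * t) * ?h' (a + t *\<^sub>R (y - a)) v)"
      if "y \<in> ball a e" "t \<in> {0..1}" for y t
      unfolding F_def
      by (intro bounded_linear_Blinfun_apply bounded_linear_const_mult
          has_derivative_bounded_linear[OF hd] mem that)
    have ch: "continuous_on (ball a e) (\<lambda>y. ?h' y v)" for v
    proof -
      have "Ck_on k (ball a e) (\<lambda>y. ?h' y v)" using Suc.prems by simp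
      then show ?thesis by (cases k) (auto intro!: continuous_at_imp_continuous_on differentiable_imp_continuous_within)
    qed
    have cF: "continuous_on (ball a e \<times> {0..1}) (\<lambda>(y, t). F y t)"
    proof (rule continuous_on_blinfun_componentwise)
      fix i :: 'e
      have "continuous_on (ball a e \<times> {0..1}) (\<lambda>(y, t). (w t * t) * ?h' (a + t *\<^sub>R (y - a)) i)"
        by (intro cont ch continuous_intros Suc.prems)
      then show "continuous_on (ball a e \<times> {0..1}) (\<lambda>x. blinfun_apply (case x of (y, t) \<Rightarrow> F y t) i)"
        by (rule continuous_on_eq) (use F in auto)
    qed
    have "continuous_on (ball a e) h"
      using Suc.prems(1) by (auto intro!: continuous_at_imp_continuous_on differentiable_imp_continuous_within)
    then have cf: "continuous_on (ball a e \<times> {0..1}) (\<lambda>(y, t). f y t)"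
      unfolding f_def using cont Suc.prems(2) by blast
    have fd: "((\<lambda>y. f y t) has_derivative blinfun_apply (F y t)) (at y within ball a e)"
      if "y \<in> ball a e" "t \<in> cbox 0 1" for y t
    proof -
      have t: "t \<in> {0..1}" using that by simp
      have "((\<lambda>y. a + t *\<^sub>R (y - a)) has_derivative (\<lambda>v. t *\<^sub>R v)) (at y)"
        by (auto intro!: derivative_eq_intros)
      from has_derivative_compose[OF this hd[OF mem[OF that(1) t]]]
      have "((\<lambda>y. h (a + t *\<^sub>R (y - a))) has_derivative (\<lambda>v. ?h' (a + t *\<^sub>R (y - a)) (t *\<^sub>R v))) (at y)" .
      then have "((\<lambda>y. f y t) has_derivative (\<lambda>v. w t * ?h' (a + t *\<^sub>R (y - a)) (t *\<^sub>R v))) (at y)"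
        unfolding f_def by (rule has_derivative_mult_right)
      moreover have "linear (?h' (a + t *\<^sub>R (y - a)))"
        using has_derivative_linear[OF hd[OF mem[OF that(1) t]]] .
      ultimately have "((\<lambda>y. f y t) has_derivative blinfun_apply (F y t)) (at y)"
        by (simp add: F[OF that(1) t] linear_cmul mult.assoc)
      then show ?thesis by (rule has_derivative_at_withinI)
    qed
    show ?case
    proof (rule Ck_on_SucI[OF open_ball])
      fix y assume y: "y \<in> ball a e"
      have intf: "f y integrable_on cbox 0 1" if "y \<in> ball a e" for y
      proof -
        have "continuous_on {0..1} (\<lambda>t. (\<lambda>(y, t). f y t) (y, t))"
          by (rule continuous_on_compose2[OF cf]) (auto intro!: continuous_intros that)
        then show ?thesis by (auto intro: integrable_continuous_interval)
      qed
      have "((\<lambda>y. integral (cbox 0 1) (f y)) has_derivative integral (cbox 0 1) (F y)) (at y within ball a e)"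
        by (rule leibniz_rule[OF fd intf _ y]) (use cF in auto)
      then have *: "((\<lambda>y. integral {0..1} (f y)) has_derivative integral {0..1} (F y)) (at y)"
        using y by (simp add: at_within_open[OF _ open_ball])
      have "F y integrable_on {0..1}"
      proof -
        have "continuous_on {0..1} (\<lambda>t. (\<lambda>(y, t). F y t) (y, t))"
          by (rule continuous_on_compose2[OF cF]) (use y in \<open>auto intro!: continuous_intros\<close>)
        then show ?thesis by (auto intro: integrable_continuous_interval)
      qed
      then have "integral {0..1} (F y) v = integral {0..1} (\<lambda>t. (w t * t) * ?h' (a + t *\<^sub>R (y - a)) v)" for v
        using blinfun_apply_integral[of "F y" "{0..1}" v] F[OF y]
        by (metis (no_types, lifting) Henstock_Kurzweil_Integration.integral_cong)
      then have "blinfun_apply (integral {0..1} (F y)) = (\<lambda>v. integral {0..1} (\<lambda>t. (w t * t) * ?h' (a + t *\<^sub>R (y - a)) v))"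
        by auto
      with * show "((\<lambda>y. integral {0..1} (\<lambda>t. w t * h (a + t *\<^sub>R (y - a)))) has_derivative
          (\<lambda>v. integral {0..1} (\<lambda>t. (w t * t) * ?h' (a + t *\<^sub>R (y - a)) v))) (at y)"
        by (simp add: f_def)
    next
      fix v
      show "Ck_on k (ball a e) (\<lambda>y. integral {0..1} (\<lambda>t. (w t * t) * ?h' (a + t *\<^sub>R (y - a)) v))"
        using Suc.prems by (intro Suc.IH continuous_intros) auto
    qed
  }
qed

text \<open>Integrate the derivative of \<open>f\<close> along the segment from \<open>a\<close> to
  \<open>y\<close>; \<open>G b\<close> is the mean of the partial derivative in direction
  \<open>b\<close> over that segment.\<close>

lemma hadamard:
  fixes f :: "'e::euclidean_space \<Rightarrow> real"
  assumes "e > 0" "smooth_on (ball a e) f"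
  obtains G where "\<And>b. smooth_on (ball a e) (G b)"
    "\<And>y. y \<in> ball a e \<Longrightarrow> f y = f a + (\<Sum>b\<in>Basis. ((y - a) \<bullet> b) * G b y)"
proof
  let ?f' = "\<lambda>y. frechet_derivative f (at y)"
  let ?G = "\<lambda>b y. integral {0..1} (\<lambda>t::real. 1 * ?f' (a + t *\<^sub>R (y - a)) b)"
  have Ck: "Ck_on k (ball a e) f" for k
    using assms(2) by (simp add: smooth_on_def)
  have Ck': "Ck_on k (ball a e) (\<lambda>y. ?f' y b)" for k b
    using Ck[of "Suc k"] by simp
  show "smooth_on (ball a e) (?G b)" for b
    unfolding smooth_on_def
    using Ck_on_segment_integral[OF assms(1) Ck', of "\<lambda>t. 1"] by simp
  show "f y = f a + (\<Sum>b\<in>Basis. ((y - a) \<bullet> b) * ?G b y)" if y: "y \<in> ball a e" for y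
  proof -
    have mem: "a + t *\<^sub>R (y - a) \<in> ball a e" if "t \<in> {0..1}" for t
    proof -
      have "\<bar>t\<bar> * norm (y - a) \<le> 1 * norm (y - a)"
        using that by (intro mult_right_mono) auto
      then show ?thesis using y by (simp add: dist_norm norm_minus_commute)
    qed
    have fd: "(f has_derivative ?f' z) (at z)" if "z \<in> ball a e" for z
      using Ck[of 1] that unfolding One_nat_def by (rule Ck_on_has_derivative)
    have lin: "linear (?f' z)" if "z \<in> ball a e" for z
      using has_derivative_linear[OF fd[OF that]] .
    have intb: "(\<lambda>t. ?f' (a + t *\<^sub>R (y - a)) b) integrable_on {0..1}" for b
    proof (rule integrable_continuous_interval, rule continuous_on_compose2[of "ball a e" "\<lambda>z. ?f' z b"])
      show "continuous_on (ball a e) (\<lambda>z. ?f' z b)"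
        using Ck'[of 0 b] by simp
      show "continuous_on {0..1} (\<lambda>t. a + t *\<^sub>R (y - a))"
        by (intro continuous_intros)
    qed (use mem in auto)
    have "((\<lambda>t. ?f' (a + t *\<^sub>R (y - a)) (y - a)) has_integral
        f (a + 1 *\<^sub>R (y - a)) - f (a + 0 *\<^sub>R (y - a))) {0..1}"
    proof (rule fundamental_theorem_of_calculus)
      fix t :: real assume t: "t \<in> {0..1}"
      have 1: "((\<lambda>t. a + t *\<^sub>R (y - a)) has_derivative (\<lambda>s. s *\<^sub>R (y - a))) (at t)"
        by (auto intro!: derivative_eq_intros)
      have "((\<lambda>t. f (a + t *\<^sub>R (y - a))) has_derivative (\<lambda>s. ?f' (a + t *\<^sub>R (y - a)) (s *\<^sub>R (y - a)))) (at t)"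
        using has_derivative_compose[OF 1 fd[OF mem[OF t]]] .
      then show "((\<lambda>t. f (a + t *\<^sub>R (y - a))) has_vector_derivative ?f' (a + t *\<^sub>R (y - a)) (y - a)) (at t within {0..1})"
        using linear_cmul[OF lin[OF mem[OF t]]]
        by (auto simp: has_vector_derivative_def intro: has_derivative_at_withinI)
    qed simp
    then have "f y - f a = integral {0..1} (\<lambda>t. ?f' (a + t *\<^sub>R (y - a)) (y - a))"
      by (simp add: integral_unique)
    also have "\<dots> = integral {0..1} (\<lambda>t. \<Sum>b\<in>Basis. ((y - a) \<bullet> b) * ?f' (a + t *\<^sub>R (y - a)) b)"
    proof (rule Henstock_Kurzweil_Integration.integral_cong)
      fix t :: real assume t: "t \<in> {0..1}"
      have "?f' (a + t *\<^sub>R (y - a)) (\<Sum>b\<in>Basis. ((y - a) \<bullet> b) *\<^sub>R b)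
          = (\<Sum>b\<in>Basis. ((y - a) \<bullet> b) * ?f' (a + t *\<^sub>R (y - a)) b)"
        by (simp add: linear_sum[OF lin[OF mem[OF t]]] linear_cmul[OF lin[OF mem[OF t]]])
      then show "?f' (a + t *\<^sub>R (y - a)) (y - a) = (\<Sum>b\<in>Basis. ((y - a) \<bullet> b) * ?f' (a + t *\<^sub>R (y - a)) b)"
        by (simp only: euclidean_representation)
    qed
    also have "\<dots> = (\<Sum>b\<in>Basis. integral {0..1} (\<lambda>t. ((y - a) \<bullet> b) * ?f' (a + t *\<^sub>R (y - a)) b))"
      by (intro Henstock_Kurzweil_Integration.integral_sum integrable_on_mult_right intb) simp
    finally show ?thesis by simp
  qed
qed


section \<open>Closure properties of smooth maps\<close>

lemma sum_fun_apply: "(\<Sum>i\<in>I. f i) x = (\<Sum>i\<in>I. f i x)"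
  by (induction I rule: infinite_finite_induct) auto

lemma smooth_on_const: "open S \<Longrightarrow> smooth_on S (\<lambda>x. c)"
  by (simp add: smooth_on_def Ck_on_const)

lemma smooth_on_add:
  "open S \<Longrightarrow> smooth_on S f \<Longrightarrow> smooth_on S g \<Longrightarrow> smooth_on S (\<lambda>x. f x + g x)"
  by (simp add: smooth_on_def Ck_on_add)

lemma smooth_on_mult:
  fixes f g :: "'e::euclidean_space \<Rightarrow> real"
  shows "open S \<Longrightarrow> smooth_on S f \<Longrightarrow> smooth_on S g \<Longrightarrow> smooth_on S (\<lambda>x. f x * g x)"
  by (simp add: smooth_on_def Ck_on_mult)

lemma smooth_on_cong:
  "open S \<Longrightarrow> (\<And>x. x \<in> S \<Longrightarrow> f x = g x) \<Longrightarrow> smooth_on S f \<Longrightarrow> smooth_on S g"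
  unfolding smooth_on_def using Ck_on_cong by blast

lemma smooth_on_subset: "smooth_on S f \<Longrightarrow> T \<subseteq> S \<Longrightarrow> smooth_on T f"
  unfolding smooth_on_def using Ck_on_subset by blast

lemma smooth_on_Un:
  "open S \<Longrightarrow> open T \<Longrightarrow> smooth_on S f \<Longrightarrow> smooth_on T f \<Longrightarrow> smooth_on (S \<union> T) f"
  by (simp add: smooth_on_def Ck_on_Un)

lemma smooth_on_compose:
  fixes T :: "'e::euclidean_space \<Rightarrow> 'f::euclidean_space"
  shows "open S \<Longrightarrow> open W \<Longrightarrow> T ` S \<subseteq> W \<Longrightarrow> smooth_on S T \<Longrightarrow> smooth_on W G \<Longrightarrow>
    smooth_on S (\<lambda>x. G (T x))"
  by (simp add: smooth_on_def Ck_on_compose)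

lemma smooth_on_imp_continuous_on: "smooth_on S f \<Longrightarrow> continuous_on S f"
  unfolding smooth_on_def by (drule spec[of _ 0]) simp

lemma smooth_on_has_derivative:
  "smooth_on S f \<Longrightarrow> x \<in> S \<Longrightarrow> (f has_derivative frechet_derivative f (at x)) (at x)"
  by (rule Ck_on_has_derivative[of 0]) (auto simp: smooth_on_def)

lemma smooth_on_frechet_derivative:
  assumes "smooth_on S f"
  shows "smooth_on S (\<lambda>x. frechet_derivative f (at x) v)"
  unfolding smooth_on_def
proof
  fix k
  have "Ck_on (Suc k) S f" using assms unfolding smooth_on_def by blast
  then show "Ck_on k S (\<lambda>x. frechet_derivative f (at x) v)" by simp
qed

lemma smooth_on_bump: "open S \<Longrightarrow> smooth_on S (bump a e)"
  by (simp add: smooth_on_def Ck_on_bump)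


section \<open>Smooth functions and tangent vectors\<close>

locale smooth_manifold =
  fixes A :: "('m::{t2_space, second_countable_topology}, 'e::euclidean_space) chart set"
  assumes atlas: "smooth_atlas A"
begin

abbreviation "SF \<equiv> smooth_functions A"
abbreviation "VF \<equiv> vector_fields A"
abbreviation "TS \<equiv> tangent_space A"

section \<open>The algebra of smooth functions and its derivations\<close>

lemma chart:
  assumes "(U, c) \<in> A"
  shows chart_open: "open U" "open (c ` U)"
    and chart_inv_cont: "continuous_on (c ` U) (inv_into U c)"
    and chart_inv: "\<And>q. q \<in> U \<Longrightarrow> inv_into U c (c q) = q"
proof -
  have "is_chart (U, c)" using atlas assms by (auto simp: smooth_atlas_def)
  then show "open U" "open (c ` U)" "continuous_on (c ` U) (inv_into U c)"
    "\<And>q. q \<in> U \<Longrightarrow> inv_into U c (c q) = q"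
    by (auto simp: is_chart_def homeomorphism_def)
qed

lemma smooth_functionsD: "f \<in> SF \<Longrightarrow> (U, c) \<in> A \<Longrightarrow> smooth_on (c ` U) (\<lambda>y. f (inv_into U c y))"
  by (auto simp: smooth_functions_def o_def)

lemma smooth_functionsI:
  "(\<And>U c. (U, c) \<in> A \<Longrightarrow> smooth_on (c ` U) (\<lambda>y. f (inv_into U c y))) \<Longrightarrow> f \<in> SF"
  by (auto simp: smooth_functions_def o_def)

lemma SF_const [simp]: "(\<lambda>q. a) \<in> SF"
  by (rule smooth_functionsI) (simp add: smooth_on_const chart_open)

lemma SF_add [simp]: "f \<in> SF \<Longrightarrow> f' \<in> SF \<Longrightarrow> f + f' \<in> SF"
  unfolding plus_fun_def
  by (rule smooth_functionsI) (simp add: smooth_on_add chart_open smooth_functionsD)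

lemma SF_mult [simp]: "f \<in> SF \<Longrightarrow> f' \<in> SF \<Longrightarrow> f * f' \<in> SF"
  unfolding times_fun_def
  by (rule smooth_functionsI) (simp add: smooth_on_mult chart_open smooth_functionsD)

lemma SF_scaleR [simp]: "f \<in> SF \<Longrightarrow> a *\<^sub>R f \<in> SF"
proof -
  assume "f \<in> SF"
  then have "(\<lambda>q. a) * f \<in> SF" by simp
  moreover have "(\<lambda>q. a) * f = a *\<^sub>R f" by (auto simp: fun_eq_iff)
  ultimately show ?thesis by simp
qed

lemma SF_uminus [simp]: "f \<in> SF \<Longrightarrow> - f \<in> SF"
  using SF_scaleR[of f "-1"] by simp

lemma SF_diff [simp]: "f \<in> SF \<Longrightarrow> f' \<in> SF \<Longrightarrow> f - f' \<in> SF"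
  using SF_add[of f "- f'"] by simp

lemma SF_sum: "finite I \<Longrightarrow> (\<And>i. i \<in> I \<Longrightarrow> f i \<in> SF) \<Longrightarrow> (\<Sum>i\<in>I. f i) \<in> SF"
proof (induction I rule: finite_induct)
  case empty
  show ?case using SF_const[of 0] by (simp add: zero_fun_def)
qed simp

lemma TS_scaleR: "v \<in> TS p \<Longrightarrow> f \<in> SF \<Longrightarrow> v (a *\<^sub>R f) = a * v f"
  by (simp add: tangent_space_def)

lemma TS_add: "v \<in> TS p \<Longrightarrow> f \<in> SF \<Longrightarrow> f' \<in> SF \<Longrightarrow> v (f + f') = v f + v f'"
  by (simp add: tangent_space_def)

lemma TS_mult: "v \<in> TS p \<Longrightarrow> f \<in> SF \<Longrightarrow> f' \<in> SF \<Longrightarrow> v (f * f') = v f * f' p + f p * v f'"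
  by (simp add: tangent_space_def)

lemma TS_uminus: "v \<in> TS p \<Longrightarrow> f \<in> SF \<Longrightarrow> v (- f) = - v f"
  using TS_scaleR[of v p f "-1"] by simp

lemma TS_diff: "v \<in> TS p \<Longrightarrow> f \<in> SF \<Longrightarrow> f' \<in> SF \<Longrightarrow> v (f - f') = v f - v f'"
  using TS_add[of v p f "- f'"] TS_uminus[of v p f'] by simp

lemma TS_const:
  assumes "v \<in> TS p"
  shows "v (\<lambda>q. a) = 0"
proof -
  let ?one = "\<lambda>q::'m. 1::real"
  have "v (?one * ?one) = v ?one + v ?one"
    using TS_mult[OF assms, of ?one ?one] by simp
  moreover have "?one * ?one = ?one" by (simp add: fun_eq_iff)
  ultimately have "v ?one = 0" by simp
  moreover have "(\<lambda>q::'m. a) = a *\<^sub>R ?one" by (simp add: fun_eq_iff)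
  ultimately show ?thesis using TS_scaleR[OF assms, of ?one a] by simp
qed

lemma TS_sum:
  assumes "v \<in> TS p"
  shows "finite I \<Longrightarrow> (\<And>i. i \<in> I \<Longrightarrow> f i \<in> SF) \<Longrightarrow> v (\<Sum>i\<in>I. f i) = (\<Sum>i\<in>I. v (f i))"
proof (induction I rule: finite_induct)
  case empty
  show ?case using TS_const[OF assms, of 0] by (simp add: zero_fun_def)
next
  case (insert i I)
  have "v (f i + sum f I) = v (f i) + v (sum f I)"
    using insert by (intro TS_add[OF assms] SF_sum) auto
  then show ?case
    using insert.IH insert.prems by (simp only: sum.insert[OF insert.hyps] insertI2)
qed

text \<open>Extension by zero. In another chart the domain is covered by two open sets: where the
  first chart takes values in \<open>W\<close>, the function is \<open>G\<close> after a transition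
  map; off the support it is 0.\<close>

lemma smooth_extension:
  assumes A: "(U, c) \<in> A" and W: "open W" "W \<subseteq> c ` U" and K: "compact K" "K \<subseteq> W"
    and G: "smooth_on W G" "\<And>y. y \<in> W - K \<Longrightarrow> G y = 0"
  shows "(\<lambda>q. if q \<in> U \<and> c q \<in> W then G (c q) else 0) \<in> SF" (is "?G \<in> SF")
proof (rule smooth_functionsI)
  fix V d assume A': "(V, d) \<in> A"
  define e where "e = inv_into V d"
  define K' where "K' = inv_into U c ` K"
  have e: "continuous_on (d ` V) e" "open (d ` V)"
    using chart_inv_cont[OF A'] chart_open[OF A'] by (auto simp: e_def)
  have ed: "e (d q) = q" if "q \<in> V" for q
    using chart_inv[OF A' that] by (simp add: e_def)
  have "compact K'"
    unfolding K'_def using K W(2)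
    by (intro compact_continuous_image continuous_on_subset[OF chart_inv_cont[OF A]]) auto
  \<comment> \<open>Here the Hausdorff property enters: the compact support is closed in the
    manifold.\<close>
  then have "open (- K')" by (simp add: compact_imp_closed open_Compl)
  define S0 where "S0 = d ` V \<inter> e -` U"
  define S1 where "S1 = S0 \<inter> (\<lambda>y. c (e y)) -` W"
  define S2 where "S2 = d ` V \<inter> e -` (- K')"
  have S0: "open S0"
    unfolding S0_def by (intro continuous_open_preimage e chart_open(1)[OF A])
  have S0_eq: "S0 = d ` (V \<inter> U)"
    unfolding S0_def using ed by auto
  have "smooth_on (d ` (V \<inter> U)) (c \<circ> inv_into V d)"
    using atlas A A' by (fastforce simp: smooth_atlas_def)
  then have tr: "smooth_on S0 (\<lambda>y. c (e y))"
    by (simp add: S0_eq e_def o_def)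
  have S1: "open S1"
    unfolding S1_def by (intro continuous_open_preimage S0 W smooth_on_imp_continuous_on tr)
  have S2: "open S2"
    unfolding S2_def by (intro continuous_open_preimage e \<open>open (- K')\<close>)
  have cover: "d ` V = S1 \<union> S2"
  proof
    show "d ` V \<subseteq> S1 \<union> S2"
    proof
      fix y assume y: "y \<in> d ` V"
      show "y \<in> S1 \<union> S2"
      proof (cases "e y \<in> K'")
        case True
        then obtain k where k: "k \<in> K" "e y = inv_into U c k" by (auto simp: K'_def)
        then obtain q where "q \<in> U" "k = c q" using K W by auto
        then have "e y = q" "q \<in> U" "c q \<in> W" using k K(2) chart_inv[OF A] by auto
        then show ?thesis using y by (auto simp: S1_def S0_def)
      qed (use y in \<open>auto simp: S2_def\<close>)
    qed
  qed (auto simp: S1_def S2_def S0_def)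
  have "smooth_on S1 (\<lambda>y. G (c (e y)))"
    by (rule smooth_on_compose[OF S1 W(1) _ smooth_on_subset[OF tr] G(1)]) (auto simp: S1_def)
  then have 1: "smooth_on S1 (\<lambda>y. ?G (e y))"
    by (rule smooth_on_cong[OF S1, rotated]) (auto simp: S1_def S0_def)
  have "?G (e y) = 0" if "y \<in> S2" for y
  proof -
    have "c (e y) \<notin> K" if "e y \<in> U"
      using \<open>y \<in> S2\<close> chart_inv[OF A that] by (force simp: S2_def K'_def)
    then show ?thesis using G(2) by auto
  qed
  then have 2: "smooth_on S2 (\<lambda>y. ?G (e y))"
    by (intro smooth_on_cong[OF S2 _ smooth_on_const[OF S2, of 0]]) simp
  show "smooth_on (d ` V) (\<lambda>y. ?G (inv_into V d y))"
    using smooth_on_Un[OF S1 S2 1 2] unfolding cover e_def .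
qed

text \<open>Coordinates around \<open>p\<close> and their partial derivatives, cut off by a bump so
  that they become global objects. The last clause says that a derivation is determined by its
  values on the coordinates; it bounds the dimension of the tangent space.\<close>

lemma local_frame:
  obtains x :: "'e \<Rightarrow> 'm \<Rightarrow> real" and E :: "'e \<Rightarrow> 'm vfield"
  where "\<And>b. x b \<in> SF" "\<And>b. E b \<in> VF"
    "\<And>b b'. b \<in> Basis \<Longrightarrow> b' \<in> Basis \<Longrightarrow> E b p (x b') = (if b = b' then 1 else 0)"
    "\<And>v. v \<in> TS p \<Longrightarrow> (\<And>b. b \<in> Basis \<Longrightarrow> v (x b) = 0) \<Longrightarrow> v = 0"
proof -
  obtain U c where A: "(U, c) \<in> A" and p: "p \<in> U"
  proof -
    have "p \<in> (\<Union>K\<in>A. fst K)" using atlas by (simp add: smooth_atlas_def)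
    then show ?thesis using that by auto
  qed
  define a where "a = c p"
  obtain r where r: "r > 0" "ball a r \<subseteq> c ` U"
    using chart_open(2)[OF A] p unfolding a_def open_contains_ball by blast
  \<comment> \<open>Half the radius keeps the closed ball outside which the bump vanishes inside
    \<open>W\<close>.\<close>
  define e where "e = r / 2"
  have e: "e > 0" using r by (simp add: e_def)
  define W where "W = ball a r"
  have W: "open W" "W \<subseteq> c ` U" "a \<in> W" using r by (auto simp: W_def)
  have K: "compact (cball a e)" "cball a e \<subseteq> W" using r by (auto simp: W_def e_def)
  define ext where "ext G = (\<lambda>q. if q \<in> U \<and> c q \<in> W then bump a e (c q) * G (c q) else (0::real))" for G
  have ext: "ext G \<in> SF" if "smooth_on W G" for G
    unfolding ext_def
    using bump_outside[OF e, of _ a]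
    by (intro smooth_extension[OF A W(1,2) K]) (auto intro!: smooth_on_mult W smooth_on_bump that)
  have ext_p: "ext G p = G a" for G
    using p W(3) bump_center[OF e, of a] by (simp add: ext_def a_def[symmetric])
  have aff: "smooth_on W (\<lambda>y. (y - a) \<bullet> b)" for b
  proof -
    have "Ck_on k W (\<lambda>y. y + (- a))" for k
      by (intro Ck_on_add Ck_on_id Ck_on_const W)
    then have "Ck_on k W (\<lambda>y. (y + (- a)) \<bullet> b)" for k
      by (rule Ck_on_bounded_linear[OF W(1) bounded_linear_inner_left])
    then show ?thesis by (simp add: smooth_on_def)
  qed
  define x where "x b = ext (\<lambda>y. (y - a) \<bullet> b)" for b
  have x: "x b \<in> SF" for b
    unfolding x_def by (intro ext aff)
  have loc: "smooth_on W (\<lambda>y. f (inv_into U c y))" if "f \<in> SF" for f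
    using smooth_functionsD[OF that A] W(2) by (rule smooth_on_subset)
  have hd: "((\<lambda>y. f (inv_into U c y)) has_derivative
      frechet_derivative (\<lambda>y. f (inv_into U c y)) (at y)) (at y)" if "f \<in> SF" "y \<in> W" for f y
    using loc[OF that(1)] that(2) by (rule smooth_on_has_derivative)
  define pd where "pd b f y = frechet_derivative (\<lambda>y. f (inv_into U c y)) (at y) b" for b :: 'e and f :: "'m \<Rightarrow> real" and y
  \<comment> \<open>The value 0 on non-smooth functions is what \<open>tangent_space\<close>
    demands.\<close>
  define E where "E b = (\<lambda>q f. if f \<in> SF then ext (pd b f) q else 0)" for b
  have pd: "pd b f y = D b" if "((\<lambda>y. f (inv_into U c y)) has_derivative D) (at y)" for b f y D
    unfolding pd_def using frechet_derivative_at[OF that] by simp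
  have E_TS: "E b q \<in> TS q" for b q
  proof (cases "q \<in> U \<and> c q \<in> W")
    case True
    then have q: "inv_into U c (c q) = q" "c q \<in> W" using chart_inv[OF A] by auto
    have sc: "pd b (k *\<^sub>R f) (c q) = k * pd b f (c q)" if "f \<in> SF" for k f
      using has_derivative_mult_right[OF hd[OF that q(2)], of k]
      by (intro trans[OF pd]) (auto simp: pd_def)
    have ad: "pd b (f + f') (c q) = pd b f (c q) + pd b f' (c q)" if "f \<in> SF" "f' \<in> SF" for f f'
      using has_derivative_add[OF hd[OF that(1) q(2)] hd[OF that(2) q(2)]]
      by (intro trans[OF pd]) (auto simp: pd_def)
    have mu: "pd b (f * f') (c q) = f q * pd b f' (c q) + pd b f (c q) * f' q" if "f \<in> SF" "f' \<in> SF" for f f'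
      using has_derivative_mult[OF hd[OF that(1) q(2)] hd[OF that(2) q(2)]]
      by (intro trans[OF pd]) (auto simp: pd_def q)
    show ?thesis
      using True unfolding tangent_space_def
      by (auto simp: E_def ext_def sc ad mu algebra_simps)
  next
    case False
    then have "E b q = 0" by (auto simp: E_def ext_def fun_eq_iff)
    then show ?thesis using subspace_tangent_space[of A q] by (simp add: subspace_0)
  qed
  have E_VF: "E b \<in> VF" for b
  proof -
    have "deriv_along (E b) f \<in> SF" if "f \<in> SF" for f
    proof -
      have "smooth_on W (pd b f)"
        unfolding pd_def using loc[OF that] by (rule smooth_on_frechet_derivative)
      then have "ext (pd b f) \<in> SF" by (rule ext)
      moreover have "deriv_along (E b) f = ext (pd b f)"
        using that by (auto simp: deriv_along_def E_def)
      ultimately show ?thesis by simp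
    qed
    then show ?thesis using E_TS by (simp add: vector_fields_def)
  qed
  have Ex: "E b p (x b') = (if b = b' then 1 else 0)" if "b \<in> Basis" "b' \<in> Basis" for b b'
  proof -
    have "(bump a e has_derivative frechet_derivative (bump a e) (at a)) (at a)"
      using smooth_on_bump[OF W(1)] W(3) by (rule smooth_on_has_derivative)
    moreover have "((\<lambda>y. (y - a) \<bullet> b') has_derivative (\<lambda>v. v \<bullet> b')) (at a)"
      by (auto intro!: derivative_eq_intros)
    ultimately have "((\<lambda>y. bump a e y * ((y - a) \<bullet> b')) has_derivative
        (\<lambda>v. bump a e a * (v \<bullet> b') + frechet_derivative (bump a e) (at a) v * ((a - a) \<bullet> b'))) (at a)"
      by (rule has_derivative_mult)
    then have "((\<lambda>y. bump a e y * ((y - a) \<bullet> b')) has_derivative (\<lambda>v. v \<bullet> b')) (at a)"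
      by (simp add: bump_center[OF e])
    then have "((\<lambda>y. x b' (inv_into U c y)) has_derivative (\<lambda>v. v \<bullet> b')) (at a)"
    proof (rule has_derivative_transform_within_open[OF _ W(1,3)])
      fix y assume "y \<in> W"
      then obtain q where "q \<in> U" "y = c q" using W by auto
      then show "bump a e y * ((y - a) \<bullet> b') = x b' (inv_into U c y)"
        using chart_inv[OF A] \<open>y \<in> W\<close> by (simp add: x_def ext_def)
    qed
    then have "pd b (x b') a = b \<bullet> b'" by (rule pd)
    then show ?thesis
      using x that by (simp add: E_def ext_p inner_Basis)
  qed
  have inj: "v = 0" if v: "v \<in> TS p" and vx: "\<And>b. b \<in> Basis \<Longrightarrow> v (x b) = 0" for v
  proof -
    have "v f = 0" for f
    proof (cases "f \<in> SF")
      case False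
      then show ?thesis using v by (auto simp: tangent_space_def)
    next
      case f: True
      obtain G where G: "\<And>b. smooth_on W (G b)"
        "\<And>y. y \<in> W \<Longrightarrow> f (inv_into U c y) = f (inv_into U c a) + (\<Sum>b\<in>Basis. ((y - a) \<bullet> b) * G b y)"
        using hadamard[OF r(1) loc[OF f, unfolded W_def]] unfolding W_def by blast
      \<comment> \<open>Globally \<open>f = f p + S + R\<close>. Coordinate and Hadamard coefficient
        both carry the bump, so \<open>S\<close> equals \<open>B * B * F\<close> and the rest is
        \<open>R\<close>. The product rule at \<open>p\<close> kills \<open>R\<close>, both of whose
        factors vanish there, and kills \<open>S\<close>, because \<open>x b\<close> is 0 at
        \<open>p\<close> and \<open>v (x b) = 0\<close>.\<close>
      define B where "B = ext (\<lambda>y. 1)"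
      have B: "B \<in> SF" unfolding B_def by (intro ext smooth_on_const W)
      define F where "F = f - (\<lambda>q. f p)"
      define S where "S = (\<Sum>b\<in>Basis. x b * ext (G b))"
      define R where "R = ((\<lambda>q. 1) - B * B) * F"
      have F: "F \<in> SF" unfolding F_def using f by simp
      have S: "S \<in> SF" unfolding S_def by (intro SF_sum SF_mult x ext G) simp
      have R: "R \<in> SF" unfolding R_def using B F by simp
      have "f q = ((\<lambda>q. f p) + S + R) q" for q
      proof (cases "q \<in> U \<and> c q \<in> W")
        case True
        have "inv_into U c (c q) = q" "inv_into U c a = p"
          using chart_inv[OF A] p True by (auto simp: a_def)
        then have "f q = f p + (\<Sum>b\<in>Basis. ((c q - a) \<bullet> b) * G b (c q))"
          using G(2)[of "c q"] True by simp
        then have s: "(\<Sum>b\<in>Basis. ((c q - a) \<bullet> b) * G b (c q)) = f q - f p" by simp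
        have "S q = (\<Sum>b\<in>Basis. bump a e (c q) ^ 2 * (((c q - a) \<bullet> b) * G b (c q)))"
          using True by (simp add: S_def x_def ext_def sum_fun_apply power2_eq_square algebra_simps)
        also have "\<dots> = bump a e (c q) ^ 2 * (f q - f p)"
          by (simp add: sum_distrib_left[symmetric] s)
        finally show ?thesis
          using True by (simp add: R_def F_def B_def ext_def algebra_simps power2_eq_square)
      next
        case False
        have "B q = 0" "S q = 0"
          using False by (auto simp: B_def ext_def S_def x_def sum_fun_apply)
        then show ?thesis by (simp add: R_def F_def)
      qed
      then have "v f = v ((\<lambda>q. f p) + S + R)" by (metis (no_types) HOL.ext)
      also have "\<dots> = v S + v R"
        using S R by (simp add: TS_add[OF v] TS_const[OF v])
      also have "v S = (\<Sum>b\<in>Basis. v (x b * ext (G b)))"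
        unfolding S_def by (intro TS_sum[OF v] SF_mult x ext G) simp
      also have "\<dots> = 0"
      proof (rule sum.neutral, rule ballI)
        fix b :: 'e assume "b \<in> Basis"
        then show "v (x b * ext (G b)) = 0"
          using TS_mult[OF v x ext[OF G(1)]] vx by (simp add: x_def ext_p)
      qed
      also have "v R = 0"
        unfolding R_def using TS_mult[OF v _ F, of "(\<lambda>q. 1) - B * B"] B
        by (simp add: F_def B_def ext_p)
      finally show ?thesis by simp
    qed
    then show ?thesis by (simp add: fun_eq_iff)
  qed
  show ?thesis using that[OF x E_VF Ex inj] .
qed

section \<open>Vector fields as a module over the smooth functions\<close>

lemma VF_I:
  "(\<And>p. X p \<in> TS p) \<Longrightarrow> (\<And>f. f \<in> SF \<Longrightarrow> deriv_along X f \<in> SF) \<Longrightarrow> X \<in> VF"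
  by (simp add: vector_fields_def)

lemma VF_TS: "X \<in> VF \<Longrightarrow> X p \<in> TS p"
  by (simp add: vector_fields_def)

lemma VF_SF [simp]: "X \<in> VF \<Longrightarrow> f \<in> SF \<Longrightarrow> deriv_along X f \<in> SF"
  by (simp add: vector_fields_def)

declare VF_TS [simp]

lemma TS_zero [simp]: "0 \<in> TS p"
  by (rule subspace_0[OF subspace_tangent_space])

lemma TS_plus [simp]: "u \<in> TS p \<Longrightarrow> v \<in> TS p \<Longrightarrow> u + v \<in> TS p"
  by (rule subspace_add[OF subspace_tangent_space])

lemma TS_scale [simp]: "u \<in> TS p \<Longrightarrow> a *\<^sub>R u \<in> TS p"
  by (rule subspace_scale[OF subspace_tangent_space])

lemma TS_neg [simp]: "u \<in> TS p \<Longrightarrow> - u \<in> TS p"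
  by (rule subspace_neg[OF subspace_tangent_space])

lemma TS_minus [simp]: "u \<in> TS p \<Longrightarrow> v \<in> TS p \<Longrightarrow> u - v \<in> TS p"
  by (rule subspace_diff[OF subspace_tangent_space])

lemma VF_plus [simp]: "X \<in> VF \<Longrightarrow> Y \<in> VF \<Longrightarrow> X + Y \<in> VF"
proof -
  assume XY: "X \<in> VF" "Y \<in> VF"
  have "deriv_along (X + Y) f = deriv_along X f + deriv_along Y f" for f
    by (simp add: deriv_along_def fun_eq_iff)
  then show ?thesis using XY by (intro VF_I) simp_all
qed

lemma VF_fun_scale [simp]: "f \<in> SF \<Longrightarrow> X \<in> VF \<Longrightarrow> fun_scale f X \<in> VF"
proof -
  assume fX: "f \<in> SF" "X \<in> VF"
  have "deriv_along (fun_scale f X) f' = f * deriv_along X f'" for f'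
    by (simp add: deriv_along_def fun_eq_iff fun_scale_def)
  then show ?thesis using fX by (intro VF_I) (simp_all add: fun_scale_def)
qed

lemma VF_scaleR [simp]: "X \<in> VF \<Longrightarrow> a *\<^sub>R X \<in> VF"
proof -
  assume "X \<in> VF"
  then have "fun_scale (\<lambda>q. a) X \<in> VF" by simp
  moreover have "fun_scale (\<lambda>q. a) X = a *\<^sub>R X" by (simp add: fun_scale_def fun_eq_iff)
  ultimately show ?thesis by simp
qed

lemma VF_uminus [simp]: "X \<in> VF \<Longrightarrow> - X \<in> VF"
  using VF_scaleR[of X "-1"] by simp

lemma VF_diff [simp]: "X \<in> VF \<Longrightarrow> Y \<in> VF \<Longrightarrow> X - Y \<in> VF"
  using VF_plus[of X "- Y"] by simp

lemma VF_zero [simp]: "0 \<in> VF"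
proof -
  have "deriv_along 0 f = (\<lambda>q. 0)" for f :: "'m \<Rightarrow> real"
    by (simp add: deriv_along_def fun_eq_iff)
  then show ?thesis by (intro VF_I) simp_all
qed

lemma VF_sum: "finite I \<Longrightarrow> (\<And>i. i \<in> I \<Longrightarrow> X i \<in> VF) \<Longrightarrow> (\<Sum>i\<in>I. X i) \<in> VF"
  by (induction I rule: finite_induct) auto

text \<open>The combination of the frame with coefficients \<open>v (x b)\<close> agrees with
  \<open>v\<close> on all coordinates. This transfers identities known for vector fields to single
  tangent vectors.\<close>

lemma tangent_vector_extends:
  assumes "v \<in> TS p"
  obtains X where "X \<in> VF" "X p = v"
proof -
  obtain x :: "'e \<Rightarrow> 'm \<Rightarrow> real" and E :: "'e \<Rightarrow> 'm vfield"
    where x: "\<And>b. x b \<in> SF" and E: "\<And>b. E b \<in> VF"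
      and Ex: "\<And>b b'. b \<in> Basis \<Longrightarrow> b' \<in> Basis \<Longrightarrow> E b p (x b') = (if b = b' then 1 else 0)"
      and inj: "\<And>v. v \<in> TS p \<Longrightarrow> (\<And>b. b \<in> Basis \<Longrightarrow> v (x b) = 0) \<Longrightarrow> v = 0"
    using local_frame[of p thesis] by blast
  define X where "X = (\<Sum>b\<in>Basis. v (x b) *\<^sub>R E b)"
  have X: "X \<in> VF" unfolding X_def by (intro VF_sum VF_scaleR E) simp
  have "X p (x b) = v (x b)" if "b \<in> Basis" for b
  proof -
    have "X p (x b) = (\<Sum>b'\<in>Basis. v (x b') * E b' p (x b))"
      by (simp add: X_def sum_fun_apply)
    also have "\<dots> = (\<Sum>b'\<in>Basis. if b' = b then v (x b) else 0)"
      by (intro sum.cong) (auto simp: Ex that)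
    also have "\<dots> = v (x b)"
      using that by simp
    finally show ?thesis .
  qed
  then have "X p - v = 0"
    using X assms by (intro inj) auto
  then show ?thesis using that[OF X] by simp
qed

text \<open>\<open>L\<close> reads off the coordinates and is injective on the tangent space, so
  dependence is inherited from the model space. The relation runs over indices because vectors may
  repeat.\<close>

lemma tangent_vectors_dependent:
  fixes u :: "nat \<Rightarrow> 'm tangent"
  assumes "\<And>i. i \<le> DIM('e) \<Longrightarrow> u i \<in> TS p"
  obtains k where "(\<Sum>i\<le>DIM('e). k i *\<^sub>R u i) = 0" "\<exists>i\<le>DIM('e). k i \<noteq> 0"
proof -
  obtain x :: "'e \<Rightarrow> 'm \<Rightarrow> real" 
    where x: "\<And>b. x b \<in> SF"
      and inj: "\<And>v. v \<in> TS p \<Longrightarrow> (\<And>b. b \<in> Basis \<Longrightarrow> v (x b) = 0) \<Longrightarrow> v = 0"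
    using local_frame[of p thesis] by blast
  define L :: "'m tangent \<Rightarrow> 'e" where "L v = (\<Sum>b\<in>Basis. v (x b) *\<^sub>R b)" for v
  have lin: "linear L"
    by (intro linearI) (auto simp: L_def scaleR_add_left sum.distrib scaleR_sum_right)
  have L0: "v = 0" if "v \<in> TS p" "L v = 0" for v
  proof (rule inj[OF that(1)])
    fix b :: 'e assume "b \<in> Basis"
    then have "L v \<bullet> b = v (x b)"
      by (simp add: L_def inner_sum_left inner_Basis if_distrib cong: if_cong)
    then show "v (x b) = 0" using that by simp
  qed
  show ?thesis
  proof (cases "inj_on (\<lambda>i. L (u i)) {..DIM('e)}")
    case True
    define S where "S = (\<lambda>i. L (u i)) ` {..DIM('e)}"
    have "card S = Suc DIM('e)" unfolding S_def using True by (simp add: card_image)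
    then have "dependent S"
      by (intro dependent_biggerset) (auto simp: S_def)
    moreover have "finite S" by (simp add: S_def)
    ultimately obtain w where w: "\<exists>v\<in>S. w v \<noteq> 0" "(\<Sum>v\<in>S. w v *\<^sub>R v) = 0"
      using dependent_finite by blast
    have "(\<Sum>i\<le>DIM('e). w (L (u i)) *\<^sub>R L (u i)) = 0"
      using w(2) unfolding S_def by (simp add: sum.reindex[OF True] o_def)
    then have "L (\<Sum>i\<le>DIM('e). w (L (u i)) *\<^sub>R u i) = 0"
      by (simp add: linear_sum[OF lin] linear_cmul[OF lin])
    moreover have "(\<Sum>i\<le>DIM('e). w (L (u i)) *\<^sub>R u i) \<in> TS p"
      using assms by (intro subspace_sum subspace_tangent_space) auto
    ultimately show ?thesis
      using w(1) by (intro that[of "\<lambda>i. w (L (u i))"] L0) (auto simp: S_def)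
  next
    \<comment> \<open>Two indices with the same image carry the same vector; the coefficients 1 and
      -1 give the relation.\<close>
    case False
    then obtain i j where ij: "i \<le> DIM('e)" "j \<le> DIM('e)" "i \<noteq> j" "L (u i) = L (u j)"
      by (auto simp: inj_on_def)
    then have "u i - u j = 0"
      using assms by (intro L0) (auto simp: linear_diff[OF lin])
    let ?k = "\<lambda>l. (if l = i then 1 else 0) - (if l = j then 1 else (0::real))"
    have "(\<Sum>l\<le>DIM('e). ?k l *\<^sub>R u l) = u i - u j"
      using ij by (simp add: scaleR_diff_left sum_subtractf if_distrib[of "\<lambda>a. a *\<^sub>R _"] sum.delta cong: if_cong)
    then show ?thesis
      using ij \<open>u i - u j = 0\<close> by (intro that[of ?k]) auto
  qed
qed

end


section \<open>Curvature of the Levi-Civita connection\<close>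

lemma app_endo_apply [simp]: "app_endo T X p = T p (X p)"
  by (simp add: app_endo_def)

lemma fun_scale_apply [simp]: "fun_scale f X p = f p *\<^sub>R X p"
  by (simp add: fun_scale_def)

lemma fun_scale_const: "fun_scale (\<lambda>q. a) X = a *\<^sub>R X"
  by (rule ext) simp

lemma diff_diff_diff_swap: "a - b - (c - d) = a - c - (b - (d :: 'a::ab_group_add))"
  by simp

lemma linear_map_onD:
  assumes "linear_map_on V f"
  shows "u \<in> V \<Longrightarrow> v \<in> V \<Longrightarrow> f (u + v) = f u + f v" "v \<in> V \<Longrightarrow> f (a *\<^sub>R v) = a *\<^sub>R f v"
  using assms unfolding linear_map_on_def by blast+

locale levi_civita_manifold = smooth_manifold A
  for A :: "('m::{t2_space, second_countable_topology}, 'e::euclidean_space) chart set" +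
  fixes g :: "'m \<Rightarrow> 'm tangent \<Rightarrow> 'm tangent \<Rightarrow> real" and D :: "'m connection"
  assumes metric: "riemannian_metric A g" and lc: "levi_civita A g D"
begin

section \<open>Pointwise algebra of the metric\<close>

lemma g_sym: "u \<in> TS p \<Longrightarrow> v \<in> TS p \<Longrightarrow> g p u v = g p v u"
  using metric unfolding riemannian_metric_def by blast

lemma g_linear: "u \<in> TS p \<Longrightarrow> linear_map_on (TS p) (g p u)"
  using metric unfolding riemannian_metric_def by blast

lemma g_add_right: "u \<in> TS p \<Longrightarrow> v \<in> TS p \<Longrightarrow> w \<in> TS p \<Longrightarrow> g p u (v + w) = g p u v + g p u w"
  using linear_map_onD(1)[OF g_linear] .

lemma g_scaleR_right: "u \<in> TS p \<Longrightarrow> v \<in> TS p \<Longrightarrow> g p u (a *\<^sub>R v) = a * g p u v"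
  using linear_map_onD(2)[OF g_linear, of u p v a] by simp

lemma g_uminus_right: "u \<in> TS p \<Longrightarrow> v \<in> TS p \<Longrightarrow> g p u (- v) = - g p u v"
  using g_scaleR_right[of u p v "-1"] by simp

lemma g_diff_right: "u \<in> TS p \<Longrightarrow> v \<in> TS p \<Longrightarrow> w \<in> TS p \<Longrightarrow> g p u (v - w) = g p u v - g p u w"
  using g_add_right[of u p v "- w"] g_uminus_right[of u p w] by simp

lemma g_add_left: "u \<in> TS p \<Longrightarrow> v \<in> TS p \<Longrightarrow> w \<in> TS p \<Longrightarrow> g p (v + w) u = g p v u + g p w u"
  using g_add_right[of u p v w] by (simp add: g_sym[of _ _ u])

lemma g_scaleR_left: "u \<in> TS p \<Longrightarrow> v \<in> TS p \<Longrightarrow> g p (a *\<^sub>R v) u = a * g p v u"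
  using g_scaleR_right[of u p v a] by (simp add: g_sym[of _ _ u])

lemma g_uminus_left: "u \<in> TS p \<Longrightarrow> v \<in> TS p \<Longrightarrow> g p (- v) u = - g p v u"
  using g_uminus_right[of u p v] by (simp add: g_sym[of _ _ u])

lemma g_diff_left: "u \<in> TS p \<Longrightarrow> v \<in> TS p \<Longrightarrow> w \<in> TS p \<Longrightarrow> g p (v - w) u = g p v u - g p w u"
  using g_diff_right[of u p v w] by (simp add: g_sym[of _ _ u])

lemma g_zero_right: "u \<in> TS p \<Longrightarrow> g p u 0 = 0"
  using g_scaleR_right[of u p 0 0] by simp

lemma g_zero_left: "u \<in> TS p \<Longrightarrow> g p 0 u = 0"
  using g_scaleR_left[of u p 0 0] by simp

lemmas g_simps = g_add_right g_scaleR_right g_uminus_right g_diff_right g_zero_right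
  g_add_left g_scaleR_left g_uminus_left g_diff_left g_zero_left

lemma g_sum_right:
  assumes "w \<in> TS p" "finite I" "\<And>i. i \<in> I \<Longrightarrow> u i \<in> TS p"
  shows "g p w (\<Sum>i\<in>I. k i *\<^sub>R u i) = (\<Sum>i\<in>I. k i * g p w (u i))"
  using assms(2,3)
proof (induction I rule: finite_induct)
  case empty
  show ?case using g_zero_right[OF assms(1)] by (simp only: sum.empty)
next
  case (insert i I)
  have "(\<Sum>i\<in>I. k i *\<^sub>R u i) \<in> TS p"
    using insert.prems by (intro subspace_sum subspace_tangent_space TS_scale) simp
  then have "g p w (k i *\<^sub>R u i + (\<Sum>i\<in>I. k i *\<^sub>R u i)) = k i * g p w (u i) + g p w (\<Sum>i\<in>I. k i *\<^sub>R u i)"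
    using insert.prems assms(1) by (simp add: g_add_right g_scaleR_right)
  then show ?case
    using insert.IH insert.prems by (simp only: sum.insert[OF insert.hyps] insertI2)
qed

lemma g_eqI:
  assumes "u \<in> TS p" "v \<in> TS p" "\<And>w. w \<in> TS p \<Longrightarrow> g p u w = g p v w"
  shows "u = v"
proof (rule ccontr)
  assume "u \<noteq> v"
  then have "g p (u - v) (u - v) > 0"
    using metric assms(1,2) unfolding riemannian_metric_def by (metis TS_minus right_minus_eq)
  moreover have "g p (u - v) (u - v) = g p u (u - v) - g p v (u - v)"
    using assms(1,2) by (intro g_diff_left) simp_all
  ultimately show False using assms by simp
qed

lemma g_SF [simp]: "X \<in> VF \<Longrightarrow> Y \<in> VF \<Longrightarrow> (\<lambda>p. g p (X p) (Y p)) \<in> SF"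
  using metric unfolding riemannian_metric_def by blast

section \<open>Rules of calculus for the connection\<close>

lemma affine: "affine_connection A D"
  using lc by (simp add: levi_civita_def)

lemma D_VF [simp]: "X \<in> VF \<Longrightarrow> Y \<in> VF \<Longrightarrow> D X Y \<in> VF"
  using affine unfolding affine_connection_def by blast

lemma D_add_left: "X \<in> VF \<Longrightarrow> Y \<in> VF \<Longrightarrow> Z \<in> VF \<Longrightarrow> D (X + Y) Z = D X Z + D Y Z"
  using affine unfolding affine_connection_def by blast

lemma D_add_right: "X \<in> VF \<Longrightarrow> Y \<in> VF \<Longrightarrow> Z \<in> VF \<Longrightarrow> D X (Y + Z) = D X Y + D X Z"
  using affine unfolding affine_connection_def by blast

lemma D_fun_scale_left: "f \<in> SF \<Longrightarrow> X \<in> VF \<Longrightarrow> Y \<in> VF \<Longrightarrow> D (fun_scale f X) Y = fun_scale f (D X Y)"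
  using affine unfolding affine_connection_def by blast

lemma D_fun_scale_right: "f \<in> SF \<Longrightarrow> X \<in> VF \<Longrightarrow> Y \<in> VF \<Longrightarrow>
    D X (fun_scale f Y) = fun_scale f (D X Y) + fun_scale (deriv_along X f) Y"
  using affine unfolding affine_connection_def by blast

lemma D_uminus_left: "X \<in> VF \<Longrightarrow> Y \<in> VF \<Longrightarrow> D (- X) Y = - D X Y"
  using D_fun_scale_left[of "\<lambda>q. -1" X Y] by (simp add: fun_scale_const)

lemma D_uminus_right: "X \<in> VF \<Longrightarrow> Y \<in> VF \<Longrightarrow> D X (- Y) = - D X Y"
proof -
  assume XY: "X \<in> VF" "Y \<in> VF"
  have "deriv_along X (\<lambda>q. -1) = (\<lambda>q. 0)"
    using XY by (auto simp: deriv_along_def fun_eq_iff intro: TS_const VF_TS)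
  then show ?thesis
    using D_fun_scale_right[of "\<lambda>q. -1" X Y] XY by (simp add: fun_scale_const)
qed

lemma D_diff_left: "X \<in> VF \<Longrightarrow> Y \<in> VF \<Longrightarrow> Z \<in> VF \<Longrightarrow> D (X - Y) Z = D X Z - D Y Z"
  using D_add_left[of X "- Y" Z] D_uminus_left[of Y Z] by simp

lemma D_diff_right: "X \<in> VF \<Longrightarrow> Y \<in> VF \<Longrightarrow> Z \<in> VF \<Longrightarrow> D X (Y - Z) = D X Y - D X Z"
  using D_add_right[of X Y "- Z"] D_uminus_right[of X Z] by simp

lemma D_zero_left: "Y \<in> VF \<Longrightarrow> D 0 Y = 0"
  using D_diff_left[of 0 0 Y] by simp

lemma D_zero_right: "X \<in> VF \<Longrightarrow> D X 0 = 0"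
  using D_diff_right[of X 0 0] by simp

lemma D_metric:
  assumes "X \<in> VF" "Y \<in> VF" "Z \<in> VF"
  shows "X p (\<lambda>q. g q (Y q) (Z q)) = g p (D X Y p) (Z p) + g p (Y p) (D X Z p)"
  using lc assms unfolding levi_civita_def deriv_along_def by blast

lemma D_torsion_free:
  assumes "X \<in> VF" "Y \<in> VF"
  shows "(D X Y - D Y X) p f = X p (deriv_along Y f) - Y p (deriv_along X f)"
proof -
  have "D X Y - D Y X = lie_bracket X Y"
    using lc assms unfolding levi_civita_def by blast
  then show ?thesis by (simp add: lie_bracket_def)
qed

text \<open>By torsion-freeness \<open>D X Y - D Y X\<close> is the Lie bracket; in this form it is
  visibly a vector field.\<close>

definition curv :: "'m vfield \<Rightarrow> 'm vfield \<Rightarrow> 'm vfield \<Rightarrow> 'm vfield"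
  where "curv X Y Z = D X (D Y Z) - D Y (D X Z) - D (D X Y - D Y X) Z"

lemma curv_VF [simp]: "X \<in> VF \<Longrightarrow> Y \<in> VF \<Longrightarrow> Z \<in> VF \<Longrightarrow> curv X Y Z \<in> VF"
  by (simp add: curv_def)

lemma curv_antisym: "X \<in> VF \<Longrightarrow> Y \<in> VF \<Longrightarrow> Z \<in> VF \<Longrightarrow> curv X Y Z = - curv Y X Z"
  by (simp add: curv_def D_diff_left)

lemma jacobi:
  assumes XYZ: "X \<in> VF" "Y \<in> VF" "Z \<in> VF"
  defines "br \<equiv> \<lambda>X Y. D X Y - D Y X"
  shows "br X (br Y Z) + br Y (br Z X) + br Z (br X Y) = 0"
proof -
  have br [simp]: "br X Y \<in> VF" if "X \<in> VF" "Y \<in> VF" for X Y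
    using that by (simp add: br_def)
  have ap: "br X Y p f = X p (deriv_along Y f) - Y p (deriv_along X f)" if "X \<in> VF" "Y \<in> VF" for X Y p f
    unfolding br_def using that by (rule D_torsion_free)
  have dbr: "deriv_along (br X Y) f = deriv_along X (deriv_along Y f) - deriv_along Y (deriv_along X f)"
    if "X \<in> VF" "Y \<in> VF" for X Y f
    using ap[OF that] by (simp add: fun_eq_iff deriv_along_def)
  have df: "W p (deriv_along (br X Y) f) = W p (deriv_along X (deriv_along Y f)) - W p (deriv_along Y (deriv_along X f))"
    if "W \<in> VF" "X \<in> VF" "Y \<in> VF" "f \<in> SF" for W X Y p f
    unfolding dbr[OF that(2,3)] using that by (intro TS_diff[OF VF_TS]) auto
  have "(br X (br Y Z) + br Y (br Z X) + br Z (br X Y)) p f = 0" for p f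
  proof (cases "f \<in> SF")
    case True
    then show ?thesis using XYZ by (simp add: ap df)
  next
    \<comment> \<open>Splitting the commutators used smoothness of \<open>f\<close>; on other
      functions a tangent vector is 0 by definition.\<close>
    case False
    have "br X (br Y Z) + br Y (br Z X) + br Z (br X Y) \<in> VF"
      using XYZ by simp
    then have "(br X (br Y Z) + br Y (br Z X) + br Z (br X Y)) p \<in> TS p"
      by (rule VF_TS)
    then show ?thesis using False unfolding tangent_space_def by blast
  qed
  then show ?thesis by (simp add: fun_eq_iff)
qed

text \<open>In the cyclic sum the second derivatives pair up to derivatives of brackets;
  torsion-freeness turns the remainder into the Jacobi identity.\<close>

lemma bianchi: "X \<in> VF \<Longrightarrow> Y \<in> VF \<Longrightarrow> Z \<in> VF \<Longrightarrow> curv X Y Z + curv Y Z X + curv Z X Y = 0"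
  using jacobi[of X Y Z] by (simp add: curv_def D_diff_right algebra_simps)

text \<open>The bracket of \<open>X\<close> and \<open>Y\<close> acts on the function
  \<open>g (Z, W)\<close> as a commutator. Expanding all terms by metric compatibility, the mixed
  products of first derivatives cancel.\<close>

lemma curv_skew:
  assumes "X \<in> VF" "Y \<in> VF" "Z \<in> VF" "W \<in> VF"
  shows "g p (curv X Y Z p) (W p) = - g p (curv X Y W p) (Z p)"
proof -
  let ?F = "\<lambda>q. g q (Z q) (W q)"
  have d: "deriv_along X ?F = (\<lambda>q. g q (D X Z q) (W q)) + (\<lambda>q. g q (Z q) (D X W q))" if "X \<in> VF" for X
    using D_metric[OF that assms(3,4)] by (simp add: deriv_along_def fun_eq_iff)
  have dd: "X p (deriv_along Y ?F) = g p (D X (D Y Z) p) (W p) + g p (D Y Z p) (D X W p)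
      + (g p (D X Z p) (D Y W p) + g p (Z p) (D X (D Y W) p))" if "X \<in> VF" "Y \<in> VF" for X Y
  proof -
    have "X p (deriv_along Y ?F) = X p (\<lambda>q. g q (D Y Z q) (W q)) + X p (\<lambda>q. g q (Z q) (D Y W q))"
      unfolding d[OF that(2)] using that assms by (intro TS_add[OF VF_TS] g_SF D_VF)
    then show ?thesis using that assms by (simp add: D_metric)
  qed
  have "(D X Y - D Y X) p ?F = X p (deriv_along Y ?F) - Y p (deriv_along X ?F)"
    by (rule D_torsion_free[OF assms(1,2)])
  moreover have "(D X Y - D Y X) p ?F = g p (D (D X Y - D Y X) Z p) (W p) + g p (Z p) (D (D X Y - D Y X) W p)"
    using assms by (intro D_metric VF_diff D_VF)
  ultimately have "g p (curv X Y Z p) (W p) + g p (Z p) (curv X Y W p) = 0"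
    using assms by (simp add: dd curv_def g_simps)
  then show ?thesis using assms by (simp add: g_sym[of "Z p"])
qed

lemma curv_pair_sym:
  assumes XYZW: "X \<in> VF" "Y \<in> VF" "Z \<in> VF" "W \<in> VF"
  shows "g p (curv X Y Z p) (W p) = g p (curv Z W X p) (Y p)"
proof -
  define R where "R X Y Z W = g p (curv X Y Z p) (W p)" for X Y Z W
  have a: "R X Y Z W = - R Y X Z W" if "X \<in> VF" "Y \<in> VF" "Z \<in> VF" "W \<in> VF" for X Y Z W
  proof -
    have "curv X Y Z p = - curv Y X Z p"
      using curv_antisym[OF that(1-3)] by simp
    then show ?thesis using that by (simp add: R_def g_simps)
  qed
  have s: "R X Y Z W = - R X Y W Z" if "X \<in> VF" "Y \<in> VF" "Z \<in> VF" "W \<in> VF" for X Y Z W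
    using curv_skew[OF that] by (simp add: R_def)
  have b: "R X Y Z W + R Y Z X W + R Z X Y W = 0" if "X \<in> VF" "Y \<in> VF" "Z \<in> VF" "W \<in> VF" for X Y Z W
  proof -
    have "g p ((curv X Y Z + curv Y Z X + curv Z X Y) p) (W p) = 0"
      unfolding bianchi[OF that(1-3)] using that by (simp add: g_simps)
    then show ?thesis using that by (simp add: R_def g_simps)
  qed
  show ?thesis
    \<comment> \<open>The classical octahedron argument: the Bianchi identities of the four cyclic
      arrangements, with the skew symmetries, combine linearly to the claim.\<close>
    using b[OF XYZW(1,2,3,4)] b[OF XYZW(2,3,4,1)] b[OF XYZW(3,4,1,2)] b[OF XYZW(4,1,2,3)] a[OF
      XYZW(3,1,2,4)] s[OF XYZW(2,3,4,1)] s[OF XYZW(3,4,2,1)] a[OF XYZW(4,2,3,1)] s[OF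
      XYZW(2,4,3,1)] a[OF XYZW(4,1,3,2)] s[OF XYZW(1,4,3,2)] s[OF XYZW(1,3,4,2)] a[OF
      XYZW(4,1,2,3)] s[OF XYZW(1,2,4,3)]
    unfolding R_def[symmetric] by linarith
qed


subsection \<open>Covariant derivatives of endomorphism fields\<close>

abbreviation "cd \<equiv> cov_deriv_endo D"

definition skew_endo :: "'m endo_field \<Rightarrow> bool"
  where "skew_endo T \<longleftrightarrow> (\<forall>p. \<forall>u\<in>TS p. \<forall>v\<in>TS p. g p (T p u) v = - g p u (T p v))"

lemma tensor_simps:
  assumes "tensor_field_1_1 A T"
  shows tensor_TS: "u \<in> TS p \<Longrightarrow> T p u \<in> TS p"
    and tensor_VF: "X \<in> VF \<Longrightarrow> app_endo T X \<in> VF"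
    and tensor_add: "u \<in> TS p \<Longrightarrow> v \<in> TS p \<Longrightarrow> T p (u + v) = T p u + T p v"
    and tensor_scaleR: "u \<in> TS p \<Longrightarrow> T p (a *\<^sub>R u) = a *\<^sub>R T p u"
    and tensor_uminus: "u \<in> TS p \<Longrightarrow> T p (- u) = - T p u"
    and tensor_diff: "u \<in> TS p \<Longrightarrow> v \<in> TS p \<Longrightarrow> T p (u - v) = T p u - T p v"
    and tensor_zero: "T p 0 = 0"
proof -
  have lin: "linear_map_on (TS p) (T p)" for p
    using assms unfolding tensor_field_1_1_def by blast
  show *: "T p u \<in> TS p" if "u \<in> TS p" for u
    using assms that unfolding tensor_field_1_1_def by blast
  show "app_endo T X \<in> VF" if "X \<in> VF" for X
    using assms that unfolding tensor_field_1_1_def by blast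
  show add: "T p (u + v) = T p u + T p v" if "u \<in> TS p" "v \<in> TS p" for u v
    using linear_map_onD(1)[OF lin that] .
  show sc: "T p (a *\<^sub>R u) = a *\<^sub>R T p u" if "u \<in> TS p" for a u
    using linear_map_onD(2)[OF lin that] .
  show um: "T p (- u) = - T p u" if "u \<in> TS p" for u
    using sc[OF that, of "-1"] by simp
  show "T p (u - v) = T p u - T p v" if "u \<in> TS p" "v \<in> TS p" for u v
    using add[of u "- v"] um[of v] that by simp
  show "T p 0 = 0"
    using sc[of 0 0] by simp
qed

lemma cd_apply: "cd T X Y p = D X (app_endo T Y) p - T p (D X Y p)"
  by (simp add: cov_deriv_endo_def)

lemma cd_VF: "tensor_field_1_1 A T \<Longrightarrow> X \<in> VF \<Longrightarrow> Y \<in> VF \<Longrightarrow> cd T X Y \<in> VF"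
  by (simp add: cov_deriv_endo_def tensor_VF)

text \<open>Differentiate \<open>g (T Y, Z) = - g (Y, T Z)\<close>; the terms in which only
  \<open>Y\<close> or only \<open>Z\<close> is differentiated cancel by skewness of
  \<open>T\<close>.\<close>

lemma cd_skew:
  assumes T: "tensor_field_1_1 A T" and sk: "skew_endo T" and XYZ: "X \<in> VF" "Y \<in> VF" "Z \<in> VF"
  shows "g p (cd T X Y p) (Z p) = - g p (Y p) (cd T X Z p)"
proof -
  have sk': "g q (T q u) v = - g q u (T q v)" if "u \<in> TS q" "v \<in> TS q" for q u v
    using sk that unfolding skew_endo_def by blast
  have TY: "app_endo T Y \<in> VF" "app_endo T Z \<in> VF" using T XYZ by (simp_all add: tensor_VF)
  have "(\<lambda>q. g q (app_endo T Y q) (Z q)) = - (\<lambda>q. g q (Y q) (app_endo T Z q))"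
    using XYZ by (simp add: fun_eq_iff sk')
  then have "X p (\<lambda>q. g q (app_endo T Y q) (Z q)) = - X p (\<lambda>q. g q (Y q) (app_endo T Z q))"
    using TS_uminus[OF VF_TS[OF XYZ(1)] g_SF[OF XYZ(2) TY(2)]] by metis
  then have "g p (D X (app_endo T Y) p) (Z p) + g p (T p (Y p)) (D X Z p)
      = - (g p (D X Y p) (T p (Z p)) + g p (Y p) (D X (app_endo T Z) p))"
    using D_metric[OF XYZ(1) TY(1) XYZ(3), of p] D_metric[OF XYZ(1,2) TY(2), of p] by simp
  then show ?thesis
    using XYZ T TY by (simp add: cd_apply g_simps tensor_TS sk')
qed

text \<open>A Leibniz rule: the left side is the covariant derivative of the composite of
  \<open>S\<close> and \<open>T\<close>, left unfolded so that the composite needs no tensor field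
  of its own.\<close>

lemma cd_compose:
  assumes S: "tensor_field_1_1 A S" and T: "tensor_field_1_1 A T" and "X \<in> VF" "Y \<in> VF"
  shows "D X (app_endo S (app_endo T Y)) p - S p (T p (D X Y p))
    = cd S X (app_endo T Y) p + S p (cd T X Y p)"
  using assms(3,4) by (simp add: cd_apply tensor_simps[OF S] tensor_simps[OF T])

lemma cd_split_direction:
  assumes T: "tensor_field_1_1 A T" and "X \<in> VF" "X' \<in> VF" "Y \<in> VF" "f \<in> SF"
  shows "cd T (X + fun_scale f X') Y p = cd T X Y p + f p *\<^sub>R cd T X' Y p"
  using assms(2-)
  by (simp add: cd_apply D_add_left D_fun_scale_left tensor_simps[OF T] scaleR_diff_right)

lemma ricci_identity:
  assumes T: "tensor_field_1_1 A T" and "X \<in> VF" "Y \<in> VF" "Z \<in> VF"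
  shows "curv X Y (app_endo T Z) p - T p (curv X Y Z p)
    = D X (cd T Y Z) p + cd T X (D Y Z) p - D Y (cd T X Z) p - cd T Y (D X Z) p
      - cd T (D X Y - D Y X) Z p"
  using assms(2-)
  by (simp add: curv_def cov_deriv_endo_def[of D T] D_diff_right tensor_simps[OF T])

text \<open>Kostant's formula: the skewness of \<open>\<psi>\<close> says that \<open>\<xi>\<close> is a Killing field.\<close>

lemma killing_curvature:
  assumes \<psi>: "tensor_field_1_1 A \<psi>" "skew_endo \<psi>" and \<xi>: "\<xi> \<in> VF"
    and D\<xi>: "\<And>X. X \<in> VF \<Longrightarrow> D X \<xi> = app_endo \<psi> X" and XY: "X \<in> VF" "Y \<in> VF"
  shows "cd \<psi> X Y p = curv X \<xi> Y p"
proof (rule g_eqI)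
  fix w assume "w \<in> TS p"
  then obtain Z where Z: "Z \<in> VF" "Z p = w" using tangent_vector_extends by blast
  define F where "F X Y Z = g p (cd \<psi> X Y p) (Z p)" for X Y Z
  define R where "R X Y Z W = g p (curv X Y Z p) (W p)" for X Y Z W
  have sk: "F X Y Z = - F X Z Y" if "X \<in> VF" "Y \<in> VF" "Z \<in> VF" for X Y Z
    using cd_skew[OF \<psi> that, of p] that \<psi> by (simp add: F_def g_sym[of "Y p"] cd_VF)
  have B: "R X Y \<xi> Z = F X Y Z - F Y X Z" if "X \<in> VF" "Y \<in> VF" "Z \<in> VF" for X Y Z
  proof -
    have "curv X Y \<xi> p = cd \<psi> X Y p - cd \<psi> Y X p"
    proof -
      let ?W = "D X Y - D Y X"
      have "D ?W \<xi> p = \<psi> p (?W p)"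
        using that by (subst D\<xi>) (rule VF_diff D_VF app_endo_apply | assumption)+
      also have "?W p = D X Y p - D Y X p"
        by (rule minus_apply)
      also have "\<psi> p (D X Y p - D Y X p) = \<psi> p (D X Y p) - \<psi> p (D Y X p)"
        using that by (intro tensor_diff[OF \<psi>(1)]) simp_all
      finally have W: "D ?W \<xi> p = \<psi> p (D X Y p) - \<psi> p (D Y X p)" .
      have "curv X Y \<xi> p = D X (app_endo \<psi> Y) p - D Y (app_endo \<psi> X) p - D ?W \<xi> p"
        using that by (simp only: curv_def D\<xi> minus_apply)
      also have "\<dots> = D X (app_endo \<psi> Y) p - \<psi> p (D X Y p) - (D Y (app_endo \<psi> X) p - \<psi> p (D Y X p))"
        unfolding W by (rule diff_diff_diff_swap)
      finally show ?thesis by (simp only: cd_apply)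
    qed
    then show ?thesis using that \<psi> by (simp add: R_def F_def g_simps cd_VF)
  qed
  have Rsk: "R X Y Z W = - R X Y W Z" if "X \<in> VF" "Y \<in> VF" "Z \<in> VF" "W \<in> VF" for X Y Z W
    using curv_skew[OF that] by (simp add: R_def)
  have bi: "R X Y Z \<xi> + R Y Z X \<xi> + R Z X Y \<xi> = 0"
  proof -
    have "g p ((curv X Y Z + curv Y Z X + curv Z X Y) p) (\<xi> p) = 0"
      unfolding bianchi[OF XY Z(1)] using \<xi> by (simp add: g_simps)
    then show ?thesis using XY Z \<xi> by (simp add: R_def g_simps)
  qed
  \<comment> \<open>By \<open>B\<close>, the Bianchi identity paired with \<open>\<xi>\<close> says
    that the cyclic sum of \<open>F\<close> vanishes, that is, the 2-form of \<open>\<psi>\<close>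
    is closed. So \<open>F X Y Z\<close> is minus the sum of the other two terms, which is
    \<open>R Y Z \<xi> X\<close>.\<close>
  have "F X Y Z = - R Y Z \<xi> X"
    using bi B[OF XY Z(1)] B[OF XY(2) Z(1) XY(1)] B[OF Z(1) XY]
      sk[OF XY Z(1)] sk[OF XY(2) Z(1) XY(1)] sk[OF Z(1) XY]
      Rsk[OF XY Z(1) \<xi>] Rsk[OF XY(2) Z(1) XY(1) \<xi>] Rsk[OF Z(1) XY \<xi>] by linarith
  also have "R Y Z \<xi> X = R \<xi> X Y Z"
    unfolding R_def using XY Z \<xi> by (intro curv_pair_sym)
  also have "R \<xi> X Y Z = - R X \<xi> Y Z"
    using curv_antisym[OF \<xi> XY] XY Z(1) \<xi> by (simp add: R_def g_simps)
  finally show "g p (cd \<psi> X Y p) w = g p (curv X \<xi> Y p) w"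
    using Z by (simp add: F_def R_def)
qed (use XY \<xi> \<psi> in \<open>simp_all add: cd_VF\<close>)

end


section \<open>Nearly Sasakian manifolds\<close>

locale nearly_sasakian_manifold = levi_civita_manifold A g D
  for A :: "('m::{t2_space, second_countable_topology}, 'e::euclidean_space) chart set" and g D +
  fixes \<phi> h :: "'m endo_field" and \<xi> :: "'m vfield" and \<eta> :: "'m \<Rightarrow> 'm tangent \<Rightarrow> real"
  assumes ns: "nearly_sasakian A \<phi> \<xi> \<eta> g D" and st: "structure_tensor A \<phi> \<xi> D h"
begin

abbreviation "P \<equiv> cd \<phi>"
abbreviation "Q \<equiv> cd h"

section \<open>Pointwise algebra of the almost contact metric structure\<close>

lemma acm: "almost_contact_metric A \<phi> \<xi> \<eta> g"
  using ns unfolding nearly_sasakian_def by blast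

lemma phi_tensor: "tensor_field_1_1 A \<phi>"
  using acm unfolding almost_contact_metric_def by blast

lemma h_tensor: "tensor_field_1_1 A h"
  using st unfolding structure_tensor_def by blast

lemma eta_form: "one_form A \<eta>"
  using acm unfolding almost_contact_metric_def by blast

lemma xi_VF [simp]: "\<xi> \<in> VF"
  using acm unfolding almost_contact_metric_def by blast

lemmas phi_simps [simp] = tensor_simps[OF phi_tensor]
lemmas h_simps [simp] = tensor_simps[OF h_tensor]
lemmas P_VF [simp] = cd_VF[OF phi_tensor]
lemmas Q_VF [simp] = cd_VF[OF h_tensor]

lemma eta_linear: "linear_map_on (TS p) (\<eta> p)"
  using eta_form unfolding one_form_def by blast

lemma eta_SF [simp]: "X \<in> VF \<Longrightarrow> (\<lambda>p. \<eta> p (X p)) \<in> SF"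
  using eta_form unfolding one_form_def by blast

lemma eta_add [simp]: "u \<in> TS p \<Longrightarrow> v \<in> TS p \<Longrightarrow> \<eta> p (u + v) = \<eta> p u + \<eta> p v"
  using linear_map_onD(1)[OF eta_linear] .

lemma eta_scaleR [simp]: "u \<in> TS p \<Longrightarrow> \<eta> p (a *\<^sub>R u) = a * \<eta> p u"
  using linear_map_onD(2)[OF eta_linear, of u p a] by simp

lemma eta_uminus [simp]: "u \<in> TS p \<Longrightarrow> \<eta> p (- u) = - \<eta> p u"
  using eta_scaleR[of u p "-1"] by simp

lemma eta_diff [simp]: "u \<in> TS p \<Longrightarrow> v \<in> TS p \<Longrightarrow> \<eta> p (u - v) = \<eta> p u - \<eta> p v"
  using eta_add[of u p "- v"] eta_uminus[of v p] by simp

lemma phi_phi: "u \<in> TS p \<Longrightarrow> \<phi> p (\<phi> p u) = - u + \<eta> p u *\<^sub>R \<xi> p"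
  using acm unfolding almost_contact_metric_def by blast

lemma eta_xi [simp]: "\<eta> p (\<xi> p) = 1"
  using acm unfolding almost_contact_metric_def by blast

lemma g_phi_phi: "u \<in> TS p \<Longrightarrow> v \<in> TS p \<Longrightarrow> g p (\<phi> p u) (\<phi> p v) = g p u v - \<eta> p u * \<eta> p v"
  using acm unfolding almost_contact_metric_def by blast

lemma eta_zero [simp]: "\<eta> p 0 = 0"
  using eta_scaleR[of 0 p 0] by simp

lemma xi_nonzero: "\<xi> p \<noteq> 0"
proof
  assume "\<xi> p = 0"
  then have "\<eta> p (\<xi> p) = \<eta> p 0" by (rule arg_cong)
  then show False by (simp only: eta_xi eta_zero one_neq_zero)
qed

text \<open>The formula for \<open>\<phi>\<close> squared, applied to \<open>\<phi> \<xi>\<close>,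
  makes this vector a multiple of \<open>\<xi>\<close>; one more application of
  \<open>\<phi>\<close> forces it to be 0.\<close>

lemma phi_xi [simp]: "\<phi> p (\<xi> p) = 0"
proof -
  let ?a = "\<eta> p (\<phi> p (\<xi> p))"
  have 0: "\<phi> p (\<phi> p (\<xi> p)) = 0"
    using phi_phi[of "\<xi> p" p] by simp
  then have "- \<phi> p (\<xi> p) + ?a *\<^sub>R \<xi> p = 0"
    using phi_phi[of "\<phi> p (\<xi> p)" p] by simp
  then have 1: "\<phi> p (\<xi> p) = ?a *\<^sub>R \<xi> p"
    by (simp only: neg_eq_iff_add_eq_0[symmetric] minus_minus)
  then have "\<phi> p (\<phi> p (\<xi> p)) = ?a *\<^sub>R \<phi> p (\<xi> p)"
    by (metis VF_TS phi_simps(4) xi_VF)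
  with 0 1 show ?thesis by (metis scaleR_eq_0_iff)
qed

text \<open>Compute the third power of \<open>\<phi>\<close> in two ways.\<close>

lemma eta_phi [simp]: "u \<in> TS p \<Longrightarrow> \<eta> p (\<phi> p u) = 0"
proof -
  assume u: "u \<in> TS p"
  have "\<phi> p (\<phi> p (\<phi> p u)) = - \<phi> p u + \<eta> p (\<phi> p u) *\<^sub>R \<xi> p"
    using u by (simp add: phi_phi[of "\<phi> p u"])
  moreover have "\<phi> p (\<phi> p (\<phi> p u)) = - \<phi> p u"
    unfolding phi_phi[OF u] using u by (simp only: phi_simps TS_neg TS_scale VF_TS xi_VF phi_xi scaleR_zero_right add_0_right)
  ultimately have "\<eta> p (\<phi> p u) *\<^sub>R \<xi> p = 0"
    by (metis add_cancel_right_right)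
  then show ?thesis using xi_nonzero by (metis scaleR_eq_0_iff)
qed

lemma g_xi: "u \<in> TS p \<Longrightarrow> g p u (\<xi> p) = \<eta> p u"
  using g_phi_phi[of u p "\<xi> p"] by (simp add: g_zero_right)

lemma g_xi': "u \<in> TS p \<Longrightarrow> g p (\<xi> p) u = \<eta> p u"
  using g_xi[of u p] g_sym[of u p "\<xi> p"] by simp

lemma g_phi: "u \<in> TS p \<Longrightarrow> v \<in> TS p \<Longrightarrow> g p (\<phi> p u) v = - g p u (\<phi> p v)"
proof -
  assume uv: "u \<in> TS p" "v \<in> TS p"
  have "g p (\<phi> p u) (\<phi> p (\<phi> p v)) = g p u (\<phi> p v)"
    using g_phi_phi[of u p "\<phi> p v"] uv by simp
  moreover have "g p (\<phi> p u) (\<phi> p (\<phi> p v)) = - g p (\<phi> p u) v"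
    unfolding phi_phi[OF uv(2)] using uv by (simp add: g_simps g_xi)
  ultimately show ?thesis by simp
qed

lemma phi_skew: "skew_endo \<phi>"
  using g_phi unfolding skew_endo_def by blast

section \<open>The derivative of \<open>\<xi>\<close> and the symmetries of \<open>h\<close>\<close>

lemma D_xi: "X \<in> VF \<Longrightarrow> D X \<xi> = - app_endo \<phi> X + app_endo h X"
  using st unfolding structure_tensor_def by blast

lemma D_xi_apply: "X \<in> VF \<Longrightarrow> D X \<xi> p = - \<phi> p (X p) + h p (X p)"
  by (simp only: D_xi plus_fun_apply uminus_apply app_endo_apply)

lemma eta_D_xi: "X \<in> VF \<Longrightarrow> \<eta> p (D X \<xi> p) = 0"
proof -
  assume X: "X \<in> VF"
  have "X p (\<lambda>q. g q (\<xi> q) (\<xi> q)) = X p (\<lambda>q. 1)"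
    by (simp add: g_xi)
  then show ?thesis
    using D_metric[OF X xi_VF xi_VF, of p] TS_const[OF VF_TS[OF X]] X by (simp add: g_xi g_xi')
qed

lemma eta_h [simp]: "u \<in> TS p \<Longrightarrow> \<eta> p (h p u) = 0"
proof -
  assume u: "u \<in> TS p"
  then obtain X where X: "X \<in> VF" "X p = u" by (rule tangent_vector_extends)
  then show ?thesis using eta_D_xi[OF X(1), of p] u by (simp add: D_xi_apply)
qed

lemma eta_deriv:
  assumes "X \<in> VF" "Y \<in> VF"
  shows "X p (\<lambda>q. \<eta> q (Y q)) = \<eta> p (D X Y p) + g p (Y p) (D X \<xi> p)"
  using D_metric[OF assms xi_VF, of p] assms by (simp add: g_xi)

lemma nearly:
  assumes "X \<in> VF" "Y \<in> VF"
  shows "P X Y p + P Y X p = (2 * g p (X p) (Y p)) *\<^sub>R \<xi> p - \<eta> p (X p) *\<^sub>R Y p - \<eta> p (Y p) *\<^sub>R X p"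
  using ns assms unfolding nearly_sasakian_def by blast

lemma g_nearly:
  assumes "X \<in> VF" "Y \<in> VF" "w \<in> TS p"
  shows "g p (P X Y p) w + g p (P Y X p) w
    = 2 * g p (X p) (Y p) * \<eta> p w - \<eta> p (X p) * g p (Y p) w - \<eta> p (Y p) * g p (X p) w"
  using arg_cong[OF nearly[OF assms(1,2), of p], of "\<lambda>u. g p u w"] assms
  by (simp add: g_simps g_xi')

lemma app_phi_xi: "app_endo \<phi> \<xi> = 0"
  by (rule ext) (simp add: zero_fun_def)

lemma P_X_xi: "X \<in> VF \<Longrightarrow> P X \<xi> p = - \<phi> p (D X \<xi> p)"
  by (simp add: cd_apply app_phi_xi D_zero_right)

text \<open>At \<open>X = Y = \<xi>\<close> the right side of the nearly Sasakian identity cancels.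
  So \<open>D \<xi> \<xi>\<close> is killed by \<open>\<phi>\<close>, and by \<open>\<eta>\<close>
  because \<open>\<xi>\<close> has unit length.\<close>

lemma D_xi_xi: "D \<xi> \<xi> p = 0"
proof -
  have "P \<xi> \<xi> p = 0"
  proof (rule g_eqI)
    fix w assume "w \<in> TS p"
    then show "g p (P \<xi> \<xi> p) w = g p 0 w"
      using g_nearly[of \<xi> \<xi> w p] by (simp add: g_xi g_xi' g_simps)
  qed simp_all
  then have 1: "\<phi> p (D \<xi> \<xi> p) = 0"
    by (simp add: P_X_xi)
  have "\<phi> p (\<phi> p (D \<xi> \<xi> p)) = - D \<xi> \<xi> p"
    using phi_phi[of "D \<xi> \<xi> p" p] by (simp add: eta_D_xi)
  then show ?thesis
    unfolding 1 by simp
qed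

lemma h_xi [simp]: "h p (\<xi> p) = 0"
  using D_xi_xi[of p] by (simp add: D_xi_apply)

lemma g_P_X_xi:
  assumes "X \<in> VF" "w \<in> TS p"
  shows "g p (P X \<xi> p) w = - g p (X p) w + \<eta> p (X p) * \<eta> p w - g p (\<phi> p (h p (X p))) w"
  using assms by (simp add: P_X_xi D_xi_apply phi_phi g_simps g_xi')

lemma P_xi: "Y \<in> VF \<Longrightarrow> P \<xi> Y p = \<phi> p (h p (Y p))"
proof (rule g_eqI)
  fix w assume "Y \<in> VF" "w \<in> TS p"
  then show "g p (P \<xi> Y p) w = g p (\<phi> p (h p (Y p))) w"
    using g_nearly[of \<xi> Y w p] g_P_X_xi[of Y w p] by (simp add: g_xi' g_sym[of w])
qed simp_all

text \<open>The derivative of \<open>\<phi>\<^sup>2 = - I + \<eta> \<otimes> \<xi>\<close>.\<close>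

lemma P_phi:
  assumes "X \<in> VF" "Y \<in> VF" "w \<in> TS p"
  shows "g p (P X (app_endo \<phi> Y) p) w + g p (\<phi> p (P X Y p)) w
    = \<eta> p (Y p) * g p (D X \<xi> p) w + g p (Y p) (D X \<xi> p) * \<eta> p w"
proof -
  let ?f = "\<lambda>q. \<eta> q (Y q)"
  have "app_endo \<phi> (app_endo \<phi> Y) = - Y + fun_scale ?f \<xi>"
    using assms by (intro ext) (simp add: phi_phi)
  then have "D X (app_endo \<phi> (app_endo \<phi> Y)) = - D X Y + (fun_scale ?f (D X \<xi>) + fun_scale (deriv_along X ?f) \<xi>)"
    using assms(1,2) by (simp only: D_add_right D_uminus_right D_fun_scale_right VF_uminus VF_fun_scale
        xi_VF eta_SF)
  then have "g p (D X (app_endo \<phi> (app_endo \<phi> Y)) p) w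
      = - g p (D X Y p) w + (?f p * g p (D X \<xi> p) w + X p ?f * \<eta> p w)"
    using assms by (simp add: g_simps g_xi' deriv_along_def)
  moreover have "g p (\<phi> p (\<phi> p (D X Y p))) w = - g p (D X Y p) w + \<eta> p (D X Y p) * \<eta> p w"
    using assms by (simp add: phi_phi g_simps g_xi')
  ultimately have "g p (D X (app_endo \<phi> (app_endo \<phi> Y)) p - \<phi> p (\<phi> p (D X Y p))) w
      = \<eta> p (Y p) * g p (D X \<xi> p) w + g p (Y p) (D X \<xi> p) * \<eta> p w"
    using assms by (simp add: g_simps eta_deriv algebra_simps)
  then show ?thesis
    using assms by (simp only: cd_compose[OF phi_tensor phi_tensor] g_add_left P_VF phi_simps VF_TS)
qed

text \<open>\<open>P_phi\<close> in the direction \<open>\<xi>\<close>, where the right side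
  vanishes because \<open>\<xi>\<close> is geodesic and \<open>P \<xi>\<close> is
  \<open>\<phi> h\<close>.\<close>

lemma phi_h_phi: "u \<in> TS p \<Longrightarrow> \<phi> p (h p (\<phi> p u)) = h p u"
proof (rule g_eqI)
  fix w assume u: "u \<in> TS p" and w: "w \<in> TS p"
  obtain Y where Y: "Y \<in> VF" "Y p = u" using tangent_vector_extends[OF u] by blast
  have "g p (\<phi> p (h p (\<phi> p u))) w + g p (\<phi> p (\<phi> p (h p u))) w = 0"
    using P_phi[of \<xi> Y w p] Y w u by (simp add: P_xi D_xi_xi g_zero_left g_zero_right)
  then show "g p (\<phi> p (h p (\<phi> p u))) w = g p (h p u) w"
    using u w by (simp add: phi_phi g_simps)
qed simp_all

lemma h_phi: "u \<in> TS p \<Longrightarrow> h p (\<phi> p u) = - \<phi> p (h p u)"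
proof -
  assume u: "u \<in> TS p"
  have "\<phi> p (\<phi> p (h p (\<phi> p u))) = \<phi> p (h p u)"
    using phi_h_phi[OF u] by simp
  moreover have "\<phi> p (\<phi> p (h p (\<phi> p u))) = - h p (\<phi> p u)"
    using u by (simp add: phi_phi[of "h p (\<phi> p u)"])
  ultimately show ?thesis by (metis minus_minus)
qed

text \<open>\<open>\<phi> h\<close> is skew, being the derivative of the skew \<open>\<phi>\<close>
  along \<open>\<xi>\<close>. Replacing one argument by its image under \<open>\<phi>\<close>
  transfers this to \<open>h\<close>.\<close>

lemma g_h: "u \<in> TS p \<Longrightarrow> v \<in> TS p \<Longrightarrow> g p (h p u) v = - g p u (h p v)"
proof -
  assume uv: "u \<in> TS p" "v \<in> TS p"
  have sk: "g p (\<phi> p (h p u)) v = - g p u (\<phi> p (h p v))" if uv: "u \<in> TS p" "v \<in> TS p" for u v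
  proof -
    obtain X where X: "X \<in> VF" "X p = u" using tangent_vector_extends[OF uv(1)] by blast
    obtain Y where Y: "Y \<in> VF" "Y p = v" using tangent_vector_extends[OF uv(2)] by blast
    show ?thesis
      using cd_skew[OF phi_tensor phi_skew xi_VF X(1) Y(1), of p] X Y by (simp add: P_xi)
  qed
  have "g p (\<phi> p (h p u)) (\<phi> p v) = - g p u (h p v)"
    using sk[of u "\<phi> p v"] uv by (simp add: phi_h_phi)
  moreover have "g p (\<phi> p (h p u)) (\<phi> p v) = g p (h p u) v"
    using uv by (simp add: g_phi_phi)
  ultimately show ?thesis by simp
qed

lemma h_skew: "skew_endo h"
  using g_h unfolding skew_endo_def by blast

text \<open>The endomorphism taking \<open>X\<close> to \<open>D X \<xi>\<close>. Its skewness makes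
  \<open>\<xi>\<close> a Killing field.\<close>

definition psi :: "'m endo_field"
  where "psi p u = - \<phi> p u + h p u"

lemma app_psi: "app_endo psi X = - app_endo \<phi> X + app_endo h X"
  by (simp add: psi_def fun_eq_iff)

lemma psi_tensor: "tensor_field_1_1 A psi"
proof -
  have "linear_map_on (TS p) (psi p)" for p
    unfolding linear_map_on_def by (auto simp: psi_def scaleR_diff_right)
  moreover have "psi p ` TS p \<subseteq> TS p" for p
    by (auto simp: psi_def)
  ultimately show ?thesis
    by (simp add: tensor_field_1_1_def app_psi)
qed

lemma psi_skew: "skew_endo psi"
  unfolding skew_endo_def psi_def by (simp add: g_simps g_phi g_h)

lemma curv_xi:
  assumes "X \<in> VF" "Y \<in> VF"
  shows "curv X \<xi> Y p = Q X Y p - P X Y p"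
proof -
  have "curv X \<xi> Y p = cd psi X Y p"
    using assms by (intro killing_curvature[symmetric] psi_tensor psi_skew xi_VF) (simp only: D_xi app_psi)
  also have "\<dots> = - D X (app_endo \<phi> Y) p + D X (app_endo h Y) p - (- \<phi> p (D X Y p) + h p (D X Y p))"
    using assms by (simp only: cd_apply app_psi D_add_right D_uminus_right VF_uminus phi_simps h_simps
        plus_fun_apply uminus_apply psi_def)
  also have "\<dots> = Q X Y p - P X Y p"
    by (simp add: cd_apply)
  finally show ?thesis .
qed

text \<open>In \<open>curv_xi\<close> with \<open>X = \<xi>\<close> the curvature vanishes, so
  \<open>h\<close> and \<open>\<phi>\<close> have the same derivative along
  \<open>\<xi>\<close>.\<close>

lemma Q_xi: "Y \<in> VF \<Longrightarrow> Q \<xi> Y p = \<phi> p (h p (Y p))"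
proof -
  assume Y: "Y \<in> VF"
  have "curv \<xi> \<xi> Y p = 0"
    using Y by (simp add: curv_def D_zero_left)
  then show ?thesis using curv_xi[OF xi_VF Y, of p] P_xi[OF Y, of p] by (simp only: right_minus_eq)
qed

lemma app_h_xi: "app_endo h \<xi> = 0"
  by (rule ext) (simp add: zero_fun_def)

lemma Q_X_xi: "X \<in> VF \<Longrightarrow> Q X \<xi> p = - h p (D X \<xi> p)"
  by (simp add: cd_apply app_h_xi D_zero_right)

text \<open>The covariant derivative of the relation \<open>h \<phi> + \<phi> h = 0\<close>.\<close>

lemma Q_anticomm:
  assumes "X \<in> VF" "Y \<in> VF" "w \<in> TS p"
  shows "g p (Q X (app_endo \<phi> Y) p) w + g p (h p (P X Y p)) w
    + (g p (P X (app_endo h Y) p) w + g p (\<phi> p (Q X Y p)) w) = 0"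
proof -
  have "app_endo h (app_endo \<phi> Y) = - app_endo \<phi> (app_endo h Y)"
    using assms by (intro ext) (simp add: h_phi)
  then have "D X (app_endo h (app_endo \<phi> Y)) p = - D X (app_endo \<phi> (app_endo h Y)) p"
    using assms by (simp only: D_uminus_right phi_simps h_simps uminus_apply)
  moreover have "h p (\<phi> p (D X Y p)) = - \<phi> p (h p (D X Y p))"
    using assms by (intro h_phi) simp
  ultimately have "g p (D X (app_endo h (app_endo \<phi> Y)) p - h p (\<phi> p (D X Y p))) w
      + g p (D X (app_endo \<phi> (app_endo h Y)) p - \<phi> p (h p (D X Y p))) w = 0"
    using assms by (simp add: g_simps)
  then show ?thesis
    using assms by (simp only: cd_compose[OF phi_tensor h_tensor] cd_compose[OF h_tensor phi_tensor]
        g_add_left P_VF Q_VF phi_simps h_simps VF_TS)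
qed


subsection \<open>The dimension five\<close>

text \<open>On horizontal vectors \<open>(X, Y, Z) \<mapsto> g ((\<nabla>\<^sub>X \<phi>) Y, Z)\<close> is alternating and takes the same value on
  \<open>(X, \<phi> Y, Z)\<close> and \<open>(X, Y, \<phi> Z)\<close>: it is a form of type \<open>(3,0) + (0,3)\<close> on a complex plane.\<close>

lemma P_horizontal:
  assumes dim: "DIM('e) = 5"
    and XYZ: "X \<in> VF" "Y \<in> VF" "Z \<in> VF"
    and hor: "\<eta> p (X p) = 0" "\<eta> p (Y p) = 0" "\<eta> p (Z p) = 0"
  shows "g p (P X Y p) (Z p) = 0"
proof (rule ccontr)
  assume nz: "g p (P X Y p) (Z p) \<noteq> 0"
  define H where "H X \<longleftrightarrow> X \<in> VF \<and> \<eta> p (X p) = 0" for X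
  define S where "S X Y w = g p (P X Y p) w" for X Y w
  have HX: "H X" "H Y" "H Z" using XYZ hor by (simp_all add: H_def)
  have Hphi: "H (app_endo \<phi> X)" if "H X" for X using that by (simp add: H_def)
  have s1: "S X Y (Z p) = - S X Z (Y p)" if "H X" "H Y" "H Z" for X Y Z
    using cd_skew[OF phi_tensor phi_skew, of X Y Z p] that
    by (simp add: S_def H_def g_sym[of "Y p"])
  have s2: "S X Y (Z p) = - S Y X (Z p)" if "H X" "H Y" "H Z" for X Y Z
    using g_nearly[of X Y "Z p" p] that by (simp add: S_def H_def)
  \<comment> \<open>On horizontal vectors \<open>P_phi\<close> says that the derivative of
    \<open>\<phi>\<close> anticommutes with \<open>\<phi>\<close>; skewness of \<open>\<phi>\<close>
    moves it to the last slot.\<close>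
  have s3: "S X (app_endo \<phi> Y) (Z p) = S X Y (\<phi> p (Z p))" if "H X" "H Y" "H Z" for X Y Z
    using P_phi[of X Y "Z p" p] that by (simp add: S_def H_def g_phi)
  \<comment> \<open>\<open>S\<close> vanishes when its last argument lies in the span of
    \<open>X\<close> and \<open>\<phi> X\<close>, or of \<open>Y\<close> and
    \<open>\<phi> Y\<close>.\<close>
  have v1: "S X Y (X p) = 0" if "H X" "H Y" for X Y
    using s1[OF that(1,2,1)] s2[OF that(1,1,2)] by simp
  have v2: "S X Y (\<phi> p (X p)) = 0" if "H X" "H Y" for X Y
    using s3[OF that(1,2,1)] v1[OF that(1) Hphi[OF that(2)]] by simp
  have v3: "S X Y (Y p) = 0" if "H X" "H Y" for X Y
    using s1[OF that(1,2,2)] by simp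
  have v4: "S X Y (\<phi> p (Y p)) = 0" if "H X" "H Y" for X Y
    using s3[OF that(1,2,2)] s1[OF that(1) Hphi[OF that(2)] that(2)] by simp
  have v5: "S X (app_endo \<phi> Y) (\<phi> p (Z p)) = - S X Y (Z p)" if "H X" "H Y" "H Z" for X Y Z
    using s3[OF that(1,2) Hphi[OF that(3)]] that by (simp add: S_def H_def phi_phi g_simps)
  \<comment> \<open>Six vectors in dimension five satisfy a linear relation. Pairing it with
    \<open>\<xi>\<close> and with values of \<open>P\<close> shows that a nonzero
    \<open>S X Y Z\<close> would force all its coefficients to be 0.\<close>
  define u where "u i = [X p, \<phi> p (X p), Y p, \<phi> p (Y p), Z p, \<xi> p] ! i" for i
  have u_eqs: "u 0 = X p" "u 1 = \<phi> p (X p)" "u 2 = Y p" "u 3 = \<phi> p (Y p)" "u 4 = Z p" "u 5 = \<xi> p"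
    by (simp_all only: u_def) (simp_all add: eval_nat_numeral)
  have set5: "{..DIM('e)} = {0, 1, 2, 3, 4, 5}"
    by (auto simp: dim)
  have u: "u i \<in> TS p" if "i \<le> DIM('e)" for i
  proof -
    have "i \<in> {0, 1, 2, 3, 4, 5}" using that unfolding set5[symmetric] by simp
    then show ?thesis using u_eqs XYZ by auto
  qed
  obtain k where k: "(\<Sum>i\<le>DIM('e). k i *\<^sub>R u i) = 0" "\<exists>i\<le>DIM('e). k i \<noteq> 0"
    using tangent_vectors_dependent[of u p] u by blast
  have rel: "k 0 * g p w (X p) + k 1 * g p w (\<phi> p (X p)) + k 2 * g p w (Y p) + k 3 * g p w (\<phi> p (Y p))
      + k 4 * g p w (Z p) + k 5 * g p w (\<xi> p) = 0" if "w \<in> TS p" for w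
  proof -
    have "(\<Sum>i\<le>DIM('e). k i * g p w (u i)) = 0"
      using g_sum_right[OF that finite_atMost, of "DIM('e)" u k] u k(1) g_zero_right[OF that] by simp
    then show ?thesis unfolding set5 by (simp add: u_eqs u_eqs(2)[simplified])
  qed
  have k5: "k 5 = 0"
    using rel[of "\<xi> p"] XYZ hor by (simp add: g_xi')
  have relS: "k 0 * S U V (X p) + k 1 * S U V (\<phi> p (X p)) + k 2 * S U V (Y p) + k 3 * S U V (\<phi> p (Y p))
      + k 4 * S U V (Z p) = 0" if "H U" "H V" for U V
    using rel[of "P U V p"] that k5 by (simp add: S_def H_def)
  define s t where "s = S X Y (Z p)" and "t = S X Y (\<phi> p (Z p))"
  have "s \<noteq> 0" using nz by (simp add: s_def S_def)
  have k4: "k 4 = 0"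
    using relS[of X Y] HX \<open>s \<noteq> 0\<close> by (simp add: v1 v2 v3 v4 s_def)
  have XZY: "S X Z (Y p) = - s" and YZX: "S Y Z (X p) = s"
    using s1[of X Z Y] s1[of Y Z X] s2[of X Y Z] HX by (simp_all add: s_def)
  define a where "a = S X Z (\<phi> p (Y p))"
  define b where "b = S Y Z (\<phi> p (X p))"
  \<comment> \<open>Pairing with \<open>P X Z\<close> and \<open>P X (\<phi> Z)\<close> gives a 2 by
    2 system for \<open>k 2\<close> and \<open>k 3\<close> of determinant
    \<open>- (s^2 + a^2)\<close>, nonzero because \<open>s\<close> is. The same works below for
    \<open>k 0\<close> and \<open>k 1\<close>.\<close>
  have "k 2 * (- s) + k 3 * a = 0"
    using relS[of X Z] HX by (simp add: v1 v2 v3 v4 XZY a_def k4)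
  moreover have "k 2 * a + k 3 * s = 0"
    using relS[of X "app_endo \<phi> Z"] HX Hphi by (simp add: v1 v2 s3 v5 XZY a_def k4)
  ultimately have "(k 2 * k 2 + k 3 * k 3) * s = 0"
    by algebra
  then have k23: "k 2 = 0" "k 3 = 0"
    using \<open>s \<noteq> 0\<close> by (simp_all add: sum_squares_eq_zero_iff)
  have "k 0 * s + k 1 * b = 0"
    using relS[of Y Z] HX by (simp add: v1 v2 v3 v4 YZX b_def k4 k23)
  moreover have "k 0 * b - k 1 * s = 0"
    using relS[of Y "app_endo \<phi> Z"] HX Hphi by (simp add: v1 v2 s3 v5 YZX b_def k4 k23)
  ultimately have "(k 0 * k 0 + k 1 * k 1) * s = 0"
    by algebra
  then have "k 0 = 0" "k 1 = 0"
    using \<open>s \<noteq> 0\<close> by (simp_all add: sum_squares_eq_zero_iff)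
  with k23 k4 k5 have "k i = 0" if "i \<in> {0, 1, 2, 3, 4, 5}" for i
    using that by auto
  then show False using k(2) unfolding set5[symmetric] by auto
qed

text \<open>Horizontality is required at every point, so that \<open>\<eta> (X) = 0\<close> may be
  differentiated.\<close>

definition hor :: "'m vfield \<Rightarrow> bool"
  where "hor X \<longleftrightarrow> X \<in> VF \<and> (\<forall>q. \<eta> q (X q) = 0)"

lemma hor_app_phi: "X \<in> VF \<Longrightarrow> hor (app_endo \<phi> X)"
  by (simp add: hor_def)

lemma horD [simp]: "hor X \<Longrightarrow> X \<in> VF" "hor X \<Longrightarrow> \<eta> q (X q) = 0"
  by (simp_all add: hor_def)

text \<open>The horizontal projection \<open>X - \<eta>(X) \<xi>\<close>, written with
  \<open>\<phi>\<close> squared: a value of \<open>\<phi>\<close> is horizontal, and smoothness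
  comes for free.\<close>

definition hpart :: "'m vfield \<Rightarrow> 'm vfield"
  where "hpart X = app_endo \<phi> (app_endo \<phi> (- X))"

lemma hor_hpart: "X \<in> VF \<Longrightarrow> hor (hpart X)"
  by (simp add: hpart_def hor_app_phi)

lemma hpart_decomp:
  assumes "X \<in> VF"
  shows "hpart X + fun_scale (\<lambda>q. \<eta> q (X q)) \<xi> = X"
proof
  fix p
  have "hpart X p = - (- X p) + (- \<eta> p (X p)) *\<^sub>R \<xi> p"
    using phi_phi[of "- X p" p] assms
    by (simp only: hpart_def app_endo_apply uminus_apply eta_uminus VF_TS TS_neg)
  then show "(hpart X + fun_scale (\<lambda>q. \<eta> q (X q)) \<xi>) p = X p"
    by (simp only: plus_fun_apply fun_scale_apply scaleR_minus_left minus_minus uminus_add_conv_diff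
        add.assoc add_uminus_conv_diff diff_add_cancel)
qed

text \<open>Split \<open>X\<close>, \<open>Y\<close> and \<open>w\<close> into horizontal parts and
  multiples of \<open>\<xi>\<close>. The purely horizontal term is 0 by assumption, and skewness of
  \<open>T\<close> reduces the others to derivatives along \<open>\<xi>\<close> or of
  \<open>T\<close> at \<open>\<xi>\<close>. It serves for both \<open>\<phi>\<close> and
  \<open>h\<close>.\<close>

lemma cd_formula:
  assumes T: "tensor_field_1_1 A T" "skew_endo T"
    and hv: "\<And>X Y Z. hor X \<Longrightarrow> hor Y \<Longrightarrow> hor Z \<Longrightarrow> g p (cd T X Y p) (Z p) = 0"
    and xi: "cd T \<xi> \<xi> p = 0"
    and XYw: "X \<in> VF" "Y \<in> VF" "w \<in> TS p"
  shows "g p (cd T X Y p) w = \<eta> p (X p) * g p (cd T \<xi> Y p) w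
    + \<eta> p (Y p) * g p (cd T X \<xi> p) w - \<eta> p w * g p (cd T X \<xi> p) (Y p)"
proof -
  obtain Z where Z: "Z \<in> VF" "Z p = w" using tangent_vector_extends[OF XYw(3)] by blast
  note cdVF [simp] = cd_VF[OF T(1)]
  define X' where "X' = hpart X"
  have X': "hor X'" using XYw by (simp add: X'_def hor_hpart)
  have split: "g p (cd T X Y p) w = g p (cd T X' Y p) w + \<eta> p (X p) * g p (cd T \<xi> Y p) w"
    if "Y \<in> VF" "w \<in> TS p" for Y w
  proof -
    have "cd T X Y p = cd T X' Y p + \<eta> p (X p) *\<^sub>R cd T \<xi> Y p"
      using cd_split_direction[OF T(1) horD(1)[OF X'] xi_VF that(1) eta_SF[OF XYw(1)], of p]
      unfolding X'_def hpart_decomp[OF XYw(1)] .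
    then show ?thesis using that X' by (simp add: g_simps)
  qed
  define B where "B Y Z = g p (cd T X' Y p) (Z p)" for Y Z
  have skew: "B Y Z = - B Z Y" if "Y \<in> VF" "Z \<in> VF" for Y Z
    using cd_skew[OF T horD(1)[OF X'] that, of p] that X' by (simp add: B_def g_sym[of "Y p"])
  have decomp: "B Y Z = B Y (hpart Z) + \<eta> p (Z p) * B Y \<xi>" if "Y \<in> VF" "Z \<in> VF" for Y Z
  proof -
    have "Z p = hpart Z p + \<eta> p (Z p) *\<^sub>R \<xi> p"
      using fun_cong[OF hpart_decomp[OF that(2)], of p] by (simp only: plus_fun_apply fun_scale_apply)
    then have "B Y Z = g p (cd T X' Y p) (hpart Z p + \<eta> p (Z p) *\<^sub>R \<xi> p)"
      unfolding B_def by (rule arg_cong)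
    then show ?thesis
      using that X' hor_hpart[OF that(2)] by (simp add: B_def g_add_right g_scaleR_right)
  qed
  have hZ: "hpart Z \<in> VF" "hpart Y \<in> VF" using Z XYw by (simp_all add: hor_hpart)
  have "B (hpart Z) (hpart Y) = 0"
    unfolding B_def using X' XYw Z by (intro hv hor_hpart)
  then have "B Y Z = \<eta> p (Y p) * B \<xi> Z - \<eta> p (Z p) * B \<xi> Y"
    using decomp[OF XYw(2) Z(1)] decomp[OF hZ(1) XYw(2)] decomp[OF xi_VF Z(1)]
      skew[OF XYw(2) hZ(1)] skew[OF hZ(1) xi_VF] skew[OF XYw(2) xi_VF] skew[OF xi_VF xi_VF]
    by (simp add: algebra_simps)
  \<comment> \<open>Passing from \<open>X'\<close> back to \<open>X\<close> adds a multiple of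
    \<open>cd T \<xi> \<xi>\<close>, which is 0.\<close>
  moreover have "B \<xi> V = g p (cd T X \<xi> p) (V p)" if "V \<in> VF" for V
    using split[OF xi_VF VF_TS[OF that]] that by (simp add: B_def xi g_zero_left)
  ultimately have "B Y Z = \<eta> p (Y p) * g p (cd T X \<xi> p) w - \<eta> p w * g p (cd T X \<xi> p) (Y p)"
    using Z XYw(2) by simp
  then show ?thesis
    using split[OF XYw(2,3)] Z(2) by (simp add: B_def)
qed

lemma P_formula:
  assumes dim: "DIM('e) = 5" and "X \<in> VF" "Y \<in> VF" "w \<in> TS p"
  shows "g p (P X Y p) w = \<eta> p (X p) * g p (\<phi> p (h p (Y p))) w
    + \<eta> p (Y p) * (\<eta> p (X p) * \<eta> p w - g p (X p) w - g p (\<phi> p (h p (X p))) w)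
    - \<eta> p w * (\<eta> p (X p) * \<eta> p (Y p) - g p (X p) (Y p) - g p (\<phi> p (h p (X p))) (Y p))"
proof -
  have "g p (P X Y p) w = \<eta> p (X p) * g p (P \<xi> Y p) w
    + \<eta> p (Y p) * g p (P X \<xi> p) w - \<eta> p w * g p (P X \<xi> p) (Y p)"
    using assms by (intro cd_formula phi_tensor phi_skew P_horizontal) (simp_all add: P_xi)
  then show ?thesis
    using assms(2-) by (simp add: P_xi g_P_X_xi algebra_simps)
qed

text \<open>Differentiate \<open>\<eta> (Y) = 0\<close> along \<open>\<xi>\<close> and use that
  \<open>\<xi>\<close> is geodesic.\<close>

lemma eta_D_horizontal: "hor Y \<Longrightarrow> \<eta> p (D \<xi> Y p) = 0"
  using eta_deriv[of \<xi> Y p] TS_const[OF VF_TS[OF xi_VF], of p 0] by (simp add: D_xi_xi g_zero_right)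

text \<open>On horizontal vectors \<open>R(X, \<xi>)\<close> acts as \<open>\<nabla>\<^sub>X h\<close>, which anticommutes with \<open>\<phi>\<close>; so for
  \<open>t = g (\<phi> (\<nabla>\<^sub>X h) Y, Z)\<close> the left-hand side of the Ricci identity for \<open>\<phi>\<close> is \<open>- 2 t\<close>, while its
  right-hand side is \<open>t\<close>.\<close>

lemma Q_horizontal:
  assumes dim: "DIM('e) = 5" and XYZ: "hor X" "hor Y" "hor Z"
  shows "g p (Q X Y p) (Z p) = 0"
proof -
  have VF: "X \<in> VF" "Y \<in> VF" "Z \<in> VF" using XYZ by simp_all
  have P0: "g q (P U V q) w = 0"
    if "U \<in> VF" "V \<in> VF" "w \<in> TS q" "\<eta> q (U q) = 0" "\<eta> q (V q) = 0" "\<eta> q w = 0" for U V w q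
    using P_formula[OF dim that(1-3)] that by simp
  have 0: "g p (\<phi> p (Q X Y p)) (Z p) = 0" if Z: "hor Z" for Z
  proof -
    let ?w = "Z p"
    have w: "?w \<in> TS p" "\<eta> p ?w = 0" using Z by simp_all
    \<comment> \<open>The bracket of \<open>X\<close> and \<open>\<xi>\<close>; it is horizontal at
      \<open>p\<close> because \<open>X\<close> is horizontal everywhere.\<close>
    let ?W = "D X \<xi> - D \<xi> X"
    have W: "?W \<in> VF" using VF by simp
    have "?W p = D X \<xi> p - D \<xi> X p" by (rule minus_apply)
    then have "\<eta> p (?W p) = \<eta> p (D X \<xi> p - D \<xi> X p)" by (rule arg_cong)
    then have \<eta>W: "\<eta> p (?W p) = 0"
      using VF XYZ by (simp only: eta_diff VF_TS D_VF xi_VF eta_D_xi eta_D_horizontal)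
    have ric: "g p (curv X \<xi> (app_endo \<phi> Y) p) ?w - g p (\<phi> p (curv X \<xi> Y p)) ?w
        = g p (D X (P \<xi> Y) p) ?w + g p (P X (D \<xi> Y) p) ?w - g p (D \<xi> (P X Y) p) ?w
          - g p (P \<xi> (D X Y) p) ?w - g p (P ?W Y p) ?w"
    proof -
      have "g p (curv X \<xi> (app_endo \<phi> Y) p - \<phi> p (curv X \<xi> Y p)) ?w
        = g p (D X (P \<xi> Y) p + P X (D \<xi> Y) p - D \<xi> (P X Y) p - P \<xi> (D X Y) p - P ?W Y p) ?w"
        unfolding ricci_identity[OF phi_tensor VF(1) xi_VF VF(2)] by (rule refl)
      then show ?thesis
        using VF w by (simp only: g_diff_left g_add_left VF_TS curv_VF D_VF xi_VF P_VF phi_simps W TS_plus TS_minus)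
    qed
    \<comment> \<open>Being an identity of fields, this can be differentiated. The two terms with
      \<open>P \<xi>\<close> make up the derivative of the composite of \<open>\<phi>\<close> and
      \<open>h\<close>, the source of the single surviving term on the right of the Ricci
      identity.\<close>
    have "P \<xi> Y = app_endo \<phi> (app_endo h Y)"
      by (rule ext) (simp add: P_xi VF)
    then have "g p (D X (P \<xi> Y) p - P \<xi> (D X Y) p) ?w
        = g p (D X (app_endo \<phi> (app_endo h Y)) p - \<phi> p (h p (D X Y p))) ?w"
      using VF by (simp only: P_xi D_VF)
    then have A: "g p (D X (P \<xi> Y) p) ?w - g p (P \<xi> (D X Y) p) ?w
        = g p (P X (app_endo h Y) p) ?w + g p (\<phi> p (Q X Y p)) ?w"
      unfolding cd_compose[OF phi_tensor h_tensor VF(1,2)]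
      using VF w by (simp only: g_diff_left g_add_left VF_TS D_VF xi_VF P_VF Q_VF phi_simps h_simps)
    \<comment> \<open>\<open>g (P X Y, Z)\<close> vanishes at every point, hence so does its
      derivative along \<open>\<xi>\<close>; and \<open>D \<xi> Z\<close> stays horizontal.\<close>
    have B: "g p (D \<xi> (P X Y) p) ?w = 0"
    proof -
      have "(\<lambda>q. g q (P X Y q) (Z q)) = (\<lambda>q. 0)"
        using VF Z XYZ by (intro ext P0) simp_all
      then have "\<xi> p (\<lambda>q. g q (P X Y q) (Z q)) = 0"
        using TS_const[OF VF_TS[OF xi_VF], of p 0] by simp
      moreover have "g p (P X Y p) (D \<xi> Z p) = 0"
        using VF Z XYZ by (intro P0) (simp_all add: eta_D_horizontal)
      ultimately show ?thesis
        using D_metric[of \<xi> "P X Y" Z p] VF Z by simp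
    qed
    have C: "g p (P X (app_endo h Y) p) ?w = 0" "g p (P X (D \<xi> Y) p) ?w = 0" "g p (P ?W Y p) ?w = 0"
      using VF XYZ w W \<eta>W by (intro P0; simp add: eta_D_horizontal)+
    have L: "g p (curv X \<xi> (app_endo \<phi> Y) p) ?w
        = g p (Q X (app_endo \<phi> Y) p) ?w - g p (P X (app_endo \<phi> Y) p) ?w"
      using VF w by (simp add: curv_xi g_diff_left)
    have L': "g p (\<phi> p (curv X \<xi> Y p)) ?w = g p (\<phi> p (Q X Y p)) ?w - g p (\<phi> p (P X Y p)) ?w"
      using VF w by (simp add: curv_xi g_diff_left)
    have E: "g p (P X (app_endo \<phi> Y) p) ?w = 0" "g p (\<phi> p (P X Y p)) ?w = 0" "g p (h p (P X Y p)) ?w = 0"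
      using VF XYZ w by (simp_all add: g_phi g_h P0)
    show ?thesis
      using ric A B C L L' E Q_anticomm[OF VF(1,2) w(1)] by linarith
  qed
  \<comment> \<open>Inserting \<open>\<phi> Z\<close> for \<open>Z\<close> removes the
    \<open>\<phi>\<close> in front of \<open>Q\<close>, since \<open>\<phi>\<close> squared is
    \<open>-1\<close> on horizontal vectors.\<close>
  have "g p (\<phi> p (Q X Y p)) (app_endo \<phi> Z p) = 0"
    using VF by (intro 0 hor_app_phi)
  then show ?thesis
    using VF XYZ by (simp add: g_phi phi_phi g_uminus_right)
qed

lemma Q_formula:
  assumes dim: "DIM('e) = 5" and XYw: "X \<in> VF" "Y \<in> VF" "w \<in> TS p"
  shows "g p (Q X Y p) w = \<eta> p (X p) * g p (\<phi> p (h p (Y p))) w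
    - \<eta> p (Y p) * (g p (\<phi> p (h p (X p))) w + g p (h p (h p (X p))) w)
    + \<eta> p w * (g p (\<phi> p (h p (X p))) (Y p) + g p (h p (h p (X p))) (Y p))"
proof -
  have "g p (Q X Y p) w = \<eta> p (X p) * g p (Q \<xi> Y p) w
    + \<eta> p (Y p) * g p (Q X \<xi> p) w - \<eta> p w * g p (Q X \<xi> p) (Y p)"
    using assms by (intro cd_formula h_tensor h_skew Q_horizontal) (simp_all add: Q_xi)
  moreover have "g p (Q X \<xi> p) w = - g p (\<phi> p (h p (X p))) w - g p (h p (h p (X p))) w" if "w \<in> TS p" for w
    using that XYw by (simp add: Q_X_xi D_xi_apply h_phi g_simps)
  ultimately show ?thesis
    using XYw by (simp add: Q_xi algebra_simps)
qed


subsection \<open>The canonical connection\<close>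

lemma canonical_difference_TS:
  assumes "X \<in> VF" "Y \<in> VF"
  shows "canonical_difference \<phi> \<xi> \<eta> g D h r X Y p \<in> TS p"
  using assms by (simp add: canonical_difference_def)

text \<open>Here \<open>\<nabla>\<phi>\<close> is explicit, so the difference tensor becomes
  algebraic. Its first term contributes a second half of
  \<open>- g ((\<phi> - h) X, Y) \<xi>\<close>, which raises the coefficient from 1/2 to 1.\<close>

lemma g_canonical_difference:
  assumes dim: "DIM('e) = 5" and XYw: "X \<in> VF" "Y \<in> VF" "w \<in> TS p"
  shows "g p (canonical_difference \<phi> \<xi> \<eta> g D h r X Y p) w
    = 1/2 * \<eta> p (X p) * g p (h p (Y p)) w - r * \<eta> p (X p) * g p (\<phi> p (Y p)) w
      + \<eta> p (Y p) * (g p (\<phi> p (X p)) w - g p (h p (X p)) w)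
      - (g p (\<phi> p (X p)) (Y p) - g p (h p (X p)) (Y p)) * \<eta> p w"
proof -
  have "g p (P X (app_endo \<phi> Y) p) w = \<eta> p (X p) * g p (h p (Y p)) w
      + \<eta> p w * (g p (h p (X p)) (Y p) - g p (\<phi> p (X p)) (Y p))"
  proof -
    have "g p (\<phi> p (h p (X p))) (\<phi> p (Y p)) = g p (h p (X p)) (Y p)"
      using XYw by (simp add: g_phi_phi)
    moreover have "g p (X p) (\<phi> p (Y p)) = - g p (\<phi> p (X p)) (Y p)"
      using XYw by (simp add: g_phi)
    ultimately show ?thesis
      using P_formula[OF dim, of X "app_endo \<phi> Y" w p] XYw by (simp add: phi_h_phi algebra_simps)
  qed
  then show ?thesis
    using XYw by (simp add: canonical_difference_def g_simps g_xi' algebra_simps)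
qed

text \<open>For horizontal \<open>X\<close> the commutator of the difference tensor with
  \<open>h\<close> is exactly the negative of \<open>Q X\<close>, whatever \<open>r\<close> is; so
  only the direction \<open>\<xi>\<close> is left.\<close>

lemma canonical_cd_h:
  assumes dim: "DIM('e) = 5" and XY: "X \<in> VF" "Y \<in> VF"
  shows "cov_deriv_endo (canonical_connection \<phi> \<xi> \<eta> g D h r) h X Y p
    = ((1 - 2 * r) * \<eta> p (X p)) *\<^sub>R \<phi> p (h p (Y p))"
proof (rule g_eqI)
  let ?K = "canonical_difference \<phi> \<xi> \<eta> g D h r"
  have K: "?K X Y p \<in> TS p" "?K X (app_endo h Y) p \<in> TS p"
    using XY by (simp_all add: canonical_difference_TS)
  have eq: "cov_deriv_endo (canonical_connection \<phi> \<xi> \<eta> g D h r) h X Y p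
      = D X (app_endo h Y) p + ?K X (app_endo h Y) p - h p (D X Y p + ?K X Y p)"
    by (simp only: cov_deriv_endo_def canonical_connection_def plus_fun_apply minus_apply app_endo_apply)
  show "cov_deriv_endo (canonical_connection \<phi> \<xi> \<eta> g D h r) h X Y p \<in> TS p"
    unfolding eq using XY K by simp
  fix w assume w: "w \<in> TS p"
  have "g p (cov_deriv_endo (canonical_connection \<phi> \<xi> \<eta> g D h r) h X Y p) w
      = g p (D X (app_endo h Y) p) w + g p (?K X (app_endo h Y) p) w
        - (g p (h p (D X Y p)) w + g p (h p (?K X Y p)) w)"
    unfolding eq using XY K w
    by (simp only: g_diff_left g_add_left VF_TS D_VF h_simps TS_plus)
  \<comment> \<open>Skewness of \<open>h\<close> moves it to \<open>w\<close>, so that both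
    difference terms have the shape of \<open>g_canonical_difference\<close>.\<close>
  also have "\<dots> = g p (Q X Y p) w + g p (?K X (app_endo h Y) p) w + g p (?K X Y p) (h p w)"
    using XY K w by (simp add: cd_apply g_diff_left g_h)
  also have "\<dots> = ((1 - 2 * r) * \<eta> p (X p)) * g p (\<phi> p (h p (Y p))) w"
    using XY w
    by (simp add: Q_formula[OF dim] g_canonical_difference[OF dim])
       (simp add: g_phi g_h h_phi g_uminus_right algebra_simps)
  finally show "g p (cov_deriv_endo (canonical_connection \<phi> \<xi> \<eta> g D h r) h X Y p) w
      = g p (((1 - 2 * r) * \<eta> p (X p)) *\<^sub>R \<phi> p (h p (Y p))) w"
    using XY w by (simp add: g_scaleR_left)
qed (use XY in simp)

lemma parallel_half:
  assumes dim: "DIM('e) = 5"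
  shows "parallel_endo A (canonical_connection \<phi> \<xi> \<eta> g D h (1/2)) h"
  unfolding parallel_endo_def
  by (intro ballI ext) (simp add: canonical_cd_h[OF dim] zero_fun_def)

text \<open>Test along \<open>\<xi>\<close> at a vector with \<open>h v\<close> nonzero:
  \<open>\<phi>\<close> preserves the length of the horizontal vector \<open>h v\<close>, so the
  scalar \<open>1 - 2 r\<close> must vanish.\<close>

lemma parallel_imp_half:
  assumes dim: "DIM('e) = 5" and par: "parallel_endo A (canonical_connection \<phi> \<xi> \<eta> g D h r) h"
    and nv: "\<not> vanishing_endo A h"
  shows "r = 1/2"
proof -
  obtain p v where v: "v \<in> TS p" "h p v \<noteq> 0"
    using nv unfolding vanishing_endo_def by blast
  obtain Y where Y: "Y \<in> VF" "Y p = v" using tangent_vector_extends[OF v(1)] by blast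
  have hv: "h p v \<in> TS p" using v by simp
  let ?C = "canonical_connection \<phi> \<xi> \<eta> g D h r"
  have "cov_deriv_endo ?C h \<xi> Y = 0"
    using par Y unfolding parallel_endo_def by (meson xi_VF)
  then have "cov_deriv_endo ?C h \<xi> Y p = 0 p"
    by (rule fun_cong)
  then have z: "((1 - 2 * r) * 1) *\<^sub>R \<phi> p (h p v) = 0"
    unfolding canonical_cd_h[OF dim xi_VF Y(1)] eta_xi Y(2) by (simp only: zero_fun_apply)
  have "\<phi> p (h p v) \<noteq> 0"
  proof
    assume "\<phi> p (h p v) = 0"
    then have "g p (\<phi> p (h p v)) (\<phi> p (h p v)) = g p 0 0"
      by (simp only:)
    then have "g p (h p v) (h p v) = 0"
      using hv v(1) by (simp add: g_phi_phi g_zero_right)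
    then show False
      using metric hv v(2) unfolding riemannian_metric_def by (metis less_irrefl)
  qed
  then have "(1 - 2 * r) * 1 = 0"
    using z unfolding scaleR_eq_0_iff by blast
  then show ?thesis by simp
qed

end

text \<open>In the Sasakian case \<open>h = 0\<close> is parallel for every \<open>r\<close>; hence
  the equivalence is claimed for \<open>h\<close> not identically zero, while \<open>r = 1/2\<close>
  suffices always.\<close>

theorem proposition7p4:
  fixes A :: "('m::{t2_space, second_countable_topology}, real ^ 5) chart set"
    and \<phi> h :: "'m endo_field"
    and \<xi> :: "'m vfield"
    and \<eta> :: "'m \<Rightarrow> 'm tangent \<Rightarrow> real"
    and g :: "'m \<Rightarrow> 'm tangent \<Rightarrow> 'm tangent \<Rightarrow> real"
    and D :: "'m connection"
    and r :: real
  assumes "connected_manifold A"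
    and "levi_civita A g D"
    and "nearly_sasakian A \<phi> \<xi> \<eta> g D"
    and "structure_tensor A \<phi> \<xi> D h"
  shows "(\<not> vanishing_endo A h \<longrightarrow>
            (parallel_endo A (canonical_connection \<phi> \<xi> \<eta> g D h r) h \<longleftrightarrow> r = 1/2)) \<and>
         (r = 1/2 \<longrightarrow> parallel_endo A (canonical_connection \<phi> \<xi> \<eta> g D h r) h)"
proof -
  have "riemannian_metric A g"
    using assms(3) unfolding nearly_sasakian_def almost_contact_metric_def by blast
  moreover have "smooth_atlas A"
    using assms(1) unfolding connected_manifold_def by blast
  ultimately interpret nearly_sasakian_manifold A g D \<phi> h \<xi> \<eta>
    using assms(2-4) by unfold_locales
  have dim: "DIM(real ^ 5) = 5" by simp
  show ?thesis
    using parallel_half[OF dim] parallel_imp_half[OF dim] by blast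
qed

end
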